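(* Let $0<L\le U$, $\theta=U/L$, and $\delta\in[0,1]$. For $\delta<1$, let $\phi:[0,1]\to[L,U]$ be the solution of the delay differential equation $$\phi'(t)=\frac{\alpha_\delta^\theta}{1-\delta}\left[\phi(t-\delta)-L\right]\quad\text{for }t\in[\delta,1],$$ with initial condition $\phi(t)=\alpha_\delta^\theta L$ for $t\in[0,\delta]$, where $\alpha_\delta^\theta$ is chosen so that $\phi(1)=U$; for $\delta=1$ set $\alpha_1^\theta=\sqrt\theta$ and $\phi\equiv\sqrt\theta L$. Then $\phi$ is the inverse CDF of a random threshold algorithm for one-max search whose $\mathrm{CVaR}_\delta$-competitive ratio is $\alpha_\delta^\theta$. Moreover, $\alpha_\delta^\theta\le\overline r(\delta)$, where $\overline r(\delta)$ is the unique positive solution of $$(\overline r(\delta)-1)\left(1+\frac{\overline r(\delta)}{\overline n(\delta)}\right)^{\overline n(\delta)}=\theta-1,\qquad \overline n(\delta)=\max\left\{1,\left\lfloor\frac{\lfloor\delta^{-1}\rfloor-1}{2}\right\rfloor\right\},$$ with the case $\delta=0$ defined by the limit $\delta\downarrow0$ (i.e. $(\overline r(0)-1)e^{\overline r(0)}=\theta-1$). In particular, $\alpha_\delta^\theta\le1+W_0\left(\frac{\theta-1}{e}\right)+O(\delta)$ as $\delta\downarrow0$ (with the implied constant depending on $\theta$), $\alpha_\delta^\theta\le\sqrt\theta$ when $\delta>\frac15$, and $\alpha_\delta^\theta=\sqrt\theta$ when $\delta\ge\frac12$.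
   Context: One-max search: prices $v_1,\dots,v_T\in[L,U]$ arrive online ($T$ unknown); a player sells one item at an accepted price, or at price $L$ if it never accepts. A random threshold algorithm draws $X$ from a distribution $\mu$ on $[L,U]$ and accepts the first price at least $X$; against a sequence with maximal price $v\in[L,U]$ its profit is $L\cdot\mathbb{1}_{X>v}+X\cdot\mathbb{1}_{X\le v}$. Conditional value-at-risk for rewards: for $\delta\in[0,1)$, $\mathrm{CVaR}_\delta[Y]=\sup_{t\in\mathbb{R}}\{t-\frac{1}{1-\delta}\mathbb{E}[(t-Y)^+]\}=\frac{1}{1-\delta}\int_0^{1-\delta}F_Y^{-1}(p)\,dp$ (expected reward over the worst $(1-\delta)$-fraction of outcomes), and $\mathrm{CVaR}_1[Y]=\operatorname{ess\,inf}Y$. For $Y$ with support in a bounded interval $[a,b]$, $F^{-1}(p)=\inf\{x\in[a,b]:F(x)\ge p\}$. The $\mathrm{CVaR}_\delta$-competitive ratio of $\mu$ is $\sup_{v\in[L,U]}\frac{v}{\mathrm{CVaR}_\delta[L\cdot\mathbb{1}_{X>v}+X\cdot\mathbb{1}_{X\le v}]}$. $W_0$ is the principal branch of the Lambert $W$ function. *)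

theory Defs
  imports "HOL-Probability.Probability" "HOL-Library.Landau_Symbols"
begin

text \<open>All suprema and infima below are taken in the reals. Wherever they are used for
  one-max search with \<open>0 < L\<close>, they range over nonempty sets that are bounded on the relevant
  side, because the profit takes values in \<open>[L, U]\<close>.\<close>

definition ess_inf :: "'a measure \<Rightarrow> ('a \<Rightarrow> real) \<Rightarrow> real" where
  "ess_inf M Y = Sup {c. AE x in M. c \<le> Y x}"

definition CVaR :: "real \<Rightarrow> 'a measure \<Rightarrow> ('a \<Rightarrow> real) \<Rightarrow> real" where
  "CVaR \<delta> M Y =
     (if \<delta> = 1 then ess_inf M Y
      else (SUP t. t - 1 / (1 - \<delta>) * (\<integral>x. max 0 (t - Y x) \<partial>M)))"

definition inverse_cdf :: "real \<Rightarrow> real \<Rightarrow> real measure \<Rightarrow> real \<Rightarrow> real" where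
  "inverse_cdf a b M p = Inf {x \<in> {a..b}. p \<le> cdf M x}"

text \<open>A random threshold algorithm is identified with the distribution of its threshold.\<close>

definition random_threshold_alg :: "real \<Rightarrow> real \<Rightarrow> real measure \<Rightarrow> bool" where
  "random_threshold_alg L U \<mu> \<longleftrightarrow> real_distribution \<mu> \<and> measure \<mu> {L..U} = 1"

definition threshold_profit :: "real \<Rightarrow> real \<Rightarrow> real \<Rightarrow> real" where
  "threshold_profit L v x = L * indicator {v<..} x + x * indicator {..v} x"

definition CVaR_competitive_ratio :: "real \<Rightarrow> real \<Rightarrow> real \<Rightarrow> real measure \<Rightarrow> real" where
  "CVaR_competitive_ratio L U \<delta> \<mu> =
     (SUP v\<in>{L..U}. v / CVaR \<delta> \<mu> (threshold_profit L v))"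

text \<open>\<open>threshold_curve L U \<delta> a \<phi>\<close>: the function \<open>\<phi>\<close>, of which only the restriction to \<open>[0, 1]\<close>
  matters, solves the delay differential equation with parameter \<open>a\<close>, and \<open>a\<close> is chosen so that
  \<open>\<phi> 1 = U\<close>. Derivatives are relative to \<open>[\<delta>, 1]\<close>, hence one-sided at the end points: for
  \<open>\<delta> > 0\<close> and \<open>a > 1\<close>, \<open>\<phi>\<close> has a kink at \<open>\<delta>\<close>. The range condition forces \<open>a \<ge> 1\<close>; without
  it there can be spurious parameters, e.g. \<open>a = - sqrt (U / L)\<close> for \<open>\<delta> \<ge> 1/2\<close>.\<close>

definition threshold_curve :: "real \<Rightarrow> real \<Rightarrow> real \<Rightarrow> real \<Rightarrow> (real \<Rightarrow> real) \<Rightarrow> bool" where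
  "threshold_curve L U \<delta> a \<phi> \<longleftrightarrow>
     \<phi> \<in> {0..1} \<rightarrow> {L..U} \<and>
     (if \<delta> = 1
      then a = sqrt (U / L) \<and> (\<forall>t\<in>{0..1}. \<phi> t = sqrt (U / L) * L)
      else (\<forall>t\<in>{0..\<delta>}. \<phi> t = a * L) \<and>
           (\<forall>t\<in>{\<delta>..1}. (\<phi> has_real_derivative a / (1 - \<delta>) * (\<phi> (t - \<delta>) - L))
                            (at t within {\<delta>..1})) \<and>
           \<phi> 1 = U)"

text \<open>The parameter depends on \<open>L\<close> and \<open>U\<close> only through \<open>\<theta> = U / L\<close>.\<close>

definition alpha :: "real \<Rightarrow> real \<Rightarrow> real" where
  "alpha \<theta> \<delta> =
     (THE a. \<exists>L U \<phi>. 0 < L \<and> L \<le> U \<and> \<theta> = U / L \<and> threshold_curve L U \<delta> a \<phi>)"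

definition n_bar :: "real \<Rightarrow> nat" where
  "n_bar \<delta> = nat (max 1 \<lfloor>(real_of_int \<lfloor>1 / \<delta>\<rfloor> - 1) / 2\<rfloor>)"

definition r_bar_equation :: "real \<Rightarrow> real \<Rightarrow> real \<Rightarrow> bool" where
  "r_bar_equation \<theta> \<delta> r \<longleftrightarrow>
     (if \<delta> = 0 then (r - 1) * exp r = \<theta> - 1
      else (r - 1) * (1 + r / real (n_bar \<delta>)) ^ n_bar \<delta> = \<theta> - 1)"

definition r_bar :: "real \<Rightarrow> real \<Rightarrow> real" where
  "r_bar \<theta> \<delta> = (THE r. 0 < r \<and> r_bar_equation \<theta> \<delta> r)"

text \<open>Principal branch of the Lambert function on \<open>[- 1 / exp 1, \<infinity>)\<close>.\<close>

definition lambert_W0 :: "real \<Rightarrow> real" where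
  "lambert_W0 x = (THE w. - 1 \<le> w \<and> w * exp w = x)"

end

theory Submission
  imports Defs
begin

text \<open>Writing \<open>\<phi> = L (1 + (a - 1) y)\<close> turns the delay equation into \<open>y' (t) = k y (t - \<delta>)\<close>,
  \<open>y = 1\<close> on \<open>[0, \<delta>]\<close>, with \<open>k = a / (1 - \<delta>)\<close>, whose solution is the delayed exponential
  \<open>y (t) = (\<Sum>j. k\<^sup>j max(0, t - j \<delta>)\<^sup>j / j!)\<close>. The end condition becomes
  \<open>(a - 1) y (1) = \<theta> - 1\<close>, whose left-hand side increases strictly in \<open>a \<ge> 1\<close>. The bound by
  \<open>r_bar\<close> is a termwise comparison of \<open>y (1)\<close> with the binomial expansion of \<open>(1 + a / n)\<^sup>n\<close>.

  For the competitive ratio, take the threshold \<open>\<phi> (t)\<close> with \<open>t\<close> uniform in \<open>[0, 1]\<close>. Against a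
  maximal price \<open>v = \<phi> (s)\<close> with \<open>s \<ge> \<delta>\<close>, the worst outcomes of probability \<open>1 - \<delta>\<close> are
  \<open>t \<in> [0, s - \<delta>] \<union> (s, 1]\<close>, and the integrated delay equation says that the mean profit on them is
  exactly \<open>v / a\<close>.\<close>

subsection \<open>The delayed exponential\<close>

text \<open>Since \<open>0 ^ 0 = 1\<close>, the term j = 0 equals 1 at every t, also at negative
  ones. For \<delta> > 0 only finitely many terms survive, and for \<delta> = 0 and t \<ge> 0 the
  series is exp (k t), so one formula covers both kinds of equation.\<close>

definition delay_exp :: "real \<Rightarrow> real \<Rightarrow> real \<Rightarrow> real" where
  "delay_exp \<delta> k t = (\<Sum>j. k ^ j * max 0 (t - real j * \<delta>) ^ j / fact j)"

lemma summable_delay_exp: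
  assumes "0 \<le> k" "0 \<le> \<delta>"
  shows "summable (\<lambda>j. k ^ j * max 0 (t - real j * \<delta>) ^ j / fact j :: real)"
proof (rule summable_comparison_test'[where N = 0])
  show "summable (\<lambda>j. (k * \<bar>t\<bar>) ^ j / fact j :: real)"
    using summable_exp[of "k * \<bar>t\<bar>"] by (simp add: field_simps)
  fix j :: nat
  have "max 0 (t - real j * \<delta>) ^ j \<le> \<bar>t\<bar> ^ j"
    using assms by (intro power_mono) (auto simp: max_def intro: order_trans[of _ t])
  then show "norm (k ^ j * max 0 (t - real j * \<delta>) ^ j / fact j) \<le> (k * \<bar>t\<bar>) ^ j / fact j"
    using assms by (auto simp: power_mult_distrib abs_mult power_abs
        intro!: divide_right_mono mult_left_mono)
qed

lemma delay_exp_mono: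
  assumes "0 \<le> k" "k \<le> k'" "t \<le> t'" "0 \<le> \<delta>"
  shows "delay_exp \<delta> k t \<le> delay_exp \<delta> k' t'"
  unfolding delay_exp_def
proof (rule suminf_le)
  show "k ^ j * max 0 (t - real j * \<delta>) ^ j / fact j
      \<le> k' ^ j * max 0 (t' - real j * \<delta>) ^ j / fact j" for j
    using assms by (intro divide_right_mono mult_mono power_mono) auto
qed (use assms in \<open>auto intro!: summable_delay_exp\<close>)

lemma sum_le_delay_exp:
  assumes "0 \<le> k" "0 \<le> \<delta>" "finite J"
  shows "(\<Sum>j\<in>J. k ^ j * max 0 (t - real j * \<delta>) ^ j / fact j) \<le> delay_exp \<delta> k t"
  unfolding delay_exp_def
  by (rule sum_le_suminf) (use assms in \<open>auto intro!: summable_delay_exp\<close>)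

lemma delay_exp_ge_1: "0 \<le> k \<Longrightarrow> 0 \<le> \<delta> \<Longrightarrow> 1 \<le> delay_exp \<delta> k t"
  using sum_le_delay_exp[of k \<delta> "{0}" t] by simp

lemma delay_exp_no_delay: "0 \<le> t \<Longrightarrow> delay_exp 0 k t = exp (k * t)"
  by (simp add: delay_exp_def exp_def power_mult_distrib divide_inverse mult.commute)

text \<open>Beyond N the truncation kills every term. For \<delta> > 0 the series is thus a finite
  sum on bounded intervals, and differentiating it needs no limit theorem.\<close>

lemma delay_exp_eq_sum:
  assumes "t \<le> real N * \<delta>" "0 \<le> \<delta>"
  shows "delay_exp \<delta> k t = (\<Sum>j\<le>N. k ^ j * max 0 (t - real j * \<delta>) ^ j / fact j)"
  unfolding delay_exp_def
proof (rule suminf_finite)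
  fix j assume "j \<notin> {..N}"
  then have "real N * \<delta> \<le> real j * \<delta>" "0 < j"
    using assms by (auto intro!: mult_right_mono)
  then show "k ^ j * max 0 (t - real j * \<delta>) ^ j / fact j = 0"
    using assms by (simp add: max_def)
qed simp

lemma delay_exp_initial:
  assumes "0 \<le> t" "t \<le> \<delta>"
  shows "delay_exp \<delta> k t = 1"
  using delay_exp_eq_sum[of t 1 \<delta> k] assms by (simp add: max_def)

text \<open>The exponent m \<ge> 2 makes both one-sided derivatives at c vanish. The power m = 1 has
  a kink, which \<open>delay_exp_has_derivative\<close> treats separately.\<close>

lemma DERIV_max_power:
  fixes c x :: real
  assumes "2 \<le> m"
  shows "((\<lambda>t. max 0 (t - c) ^ m) has_real_derivative real m * max 0 (x - c) ^ (m - 1)) (at x)"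
proof -
  consider "x < c" | "x = c" | "c < x" by linarith
  then show ?thesis
  proof cases
    case 1
    have "((\<lambda>t. 0) has_real_derivative real m * max 0 (x - c) ^ (m - 1)) (at x)"
      using 1 assms by (simp add: max_def zero_power)
    then show ?thesis
      by (rule has_field_derivative_transform_within_open[of _ _ _ "{..<c}"])
         (use 1 assms in \<open>auto simp: max_def\<close>)
  next
    case 3
    have "((\<lambda>t. (t - c) ^ m) has_real_derivative real m * max 0 (x - c) ^ (m - 1)) (at x)"
      using 3 assms by (auto simp: max_def intro!: derivative_eq_intros)
    then show ?thesis
      by (rule has_field_derivative_transform_within_open[of _ _ _ "{c<..}"])
         (use 3 assms in \<open>auto simp: max_def\<close>)
  next
    case 2
    have m: "m = Suc (m - 1)" "0 < m - 1" using assms by auto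
    \<comment> \<open>This is the difference quotient at the kink. It is dominated by |h|^(m - 1),
      and m - 1 > 0.\<close>
    have "((\<lambda>h. max 0 h ^ m / h) \<longlongrightarrow> 0) (at (0 :: real))"
    proof (rule Lim_null_comparison)
      have "norm (max 0 h ^ m / h) \<le> \<bar>h\<bar> ^ (m - 1)" for h :: real
        by (subst m(1)) (auto simp: max_def)
      then show "\<forall>\<^sub>F h in at (0 :: real). norm (max 0 h ^ m / h) \<le> \<bar>h\<bar> ^ (m - 1)"
        by simp
      have "((\<lambda>h. \<bar>h\<bar> ^ (m - 1)) \<longlongrightarrow> \<bar>0\<bar> ^ (m - 1)) (at (0 :: real))"
        by (intro tendsto_intros)
      then show "((\<lambda>h. \<bar>h\<bar> ^ (m - 1)) \<longlongrightarrow> 0) (at (0 :: real))"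
        using m(2) by (simp add: zero_power)
    qed
    then show ?thesis
      using 2 m assms by (simp add: DERIV_def zero_power)
  qed
qed

text \<open>Because t - (j + 1) \<delta> = (t - \<delta>) - j \<delta>, differentiating term j + 1
  gives k times term j at t - \<delta>, while the constant term 0 drops out.\<close>

lemma delay_exp_has_derivative:
  assumes "0 \<le> \<delta>" "t \<in> {\<delta>..T}"
  shows "(delay_exp \<delta> k has_real_derivative k * delay_exp \<delta> k (t - \<delta>)) (at t within {\<delta>..T})"
proof (cases "\<delta> = 0")
  case True
  have "((\<lambda>t. exp (k * t)) has_real_derivative k * exp (k * t)) (at t within {0..T})"
    by (auto intro!: derivative_eq_intros)
  then show ?thesis
    using True assms
    by (auto simp: delay_exp_no_delay
        intro: has_field_derivative_transform_within[of _ _ _ _ 1])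
next
  case False
  then have \<delta>: "0 < \<delta>" using assms by simp
  obtain N :: nat where N: "T / \<delta> < N" using reals_Archimedean2 by blast
  \<comment> \<open>One N serves both sides: N + 1 truncates the series on [\<delta>, T], and N
    truncates it at the shifted argument, in step with the index shift.\<close>
  then have TN: "T \<le> real (Suc N) * \<delta>" and TN': "T - \<delta> \<le> real N * \<delta>"
    using \<delta> by (auto simp: field_simps)
  let ?term = "\<lambda>j t. k ^ j * max 0 (t - real j * \<delta>) ^ j / fact j"
  have deriv: "((\<lambda>u. ?term (Suc j) u) has_real_derivative k * ?term j (t - \<delta>)) (at t within {\<delta>..T})"
    for j
  proof (cases "j = 0")
    case True
    \<comment> \<open>The linear term has a kink at \<delta>, but relative to [\<delta>, T] it
      coincides with k (u - \<delta>).\<close>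
    have "((\<lambda>u. k * (u - \<delta>)) has_real_derivative k) (at t within {\<delta>..T})"
      by (auto intro!: derivative_eq_intros)
    then have "((\<lambda>u. ?term (Suc 0) u) has_real_derivative k) (at t within {\<delta>..T})"
      by (rule has_field_derivative_transform_within[of _ _ _ _ 1]) (use assms in \<open>auto simp: max_def\<close>)
    then show ?thesis using True by simp
  next
    case False
    have eq: "t - real (Suc j) * \<delta> = t - \<delta> - real j * \<delta>" by (simp add: algebra_simps)
    have "((\<lambda>t. max 0 (t - real (Suc j) * \<delta>) ^ Suc j) has_real_derivative
        real (Suc j) * max 0 (t - real (Suc j) * \<delta>) ^ j) (at t)"
      using DERIV_max_power[of "Suc j" "real (Suc j) * \<delta>" t] False by simp
    then have "((\<lambda>t. k ^ Suc j / fact (Suc j) * max 0 (t - real (Suc j) * \<delta>) ^ Suc j) has_real_derivative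
        k ^ Suc j / fact (Suc j) * (real (Suc j) * max 0 (t - real (Suc j) * \<delta>) ^ j)) (at t)"
      by (rule DERIV_cmult)
    moreover have "k ^ Suc j / fact (Suc j) * (real (Suc j) * max 0 (t - real (Suc j) * \<delta>) ^ j)
        = k * ?term j (t - \<delta>)"
      unfolding eq by (simp add: divide_simps)
    ultimately show ?thesis
      by (auto intro: has_field_derivative_at_within)
  qed
  have "((\<lambda>u. 1 + (\<Sum>j\<le>N. ?term (Suc j) u)) has_real_derivative 0 + (\<Sum>j\<le>N. k * ?term j (t - \<delta>)))
      (at t within {\<delta>..T})"
    by (intro DERIV_add DERIV_const DERIV_sum deriv)
  then have "((\<lambda>u. 1 + (\<Sum>j\<le>N. ?term (Suc j) u)) has_real_derivative k * delay_exp \<delta> k (t - \<delta>))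
      (at t within {\<delta>..T})"
    using delay_exp_eq_sum[of "t - \<delta>" N \<delta> k] TN' assms by (simp add: sum_distrib_left)
  then show ?thesis
  proof (rule has_field_derivative_transform_within[of _ _ _ _ 1])
    fix u assume "u \<in> {\<delta>..T}"
    then show "1 + (\<Sum>j\<le>N. ?term (Suc j) u) = delay_exp \<delta> k u"
      using delay_exp_eq_sum[of u "Suc N" \<delta> k] TN assms
      by (simp only: sum.atMost_Suc_shift) simp
  qed (use assms in auto)
qed

lemma continuous_on_delay_exp_parameter:
  assumes "0 \<le> \<delta>" "0 \<le> t"
  shows "continuous_on S (\<lambda>k. delay_exp \<delta> k t)"
proof (cases "\<delta> = 0")
  case True
  then show ?thesis using assms by (auto simp: delay_exp_no_delay intro!: continuous_intros)
next
  case False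
  obtain N :: nat where N: "t / \<delta> < N" using reals_Archimedean2 by blast
  then have "t \<le> real N * \<delta>"
    using False assms by (auto simp: field_simps)
  then show ?thesis using assms by (auto simp: delay_exp_eq_sum intro!: continuous_intros)
qed

text \<open>Applied to a difference of two solutions, this gives uniqueness. For \<delta> = 0, the
  product d t * exp (- k t) is constant. For \<delta> > 0 the method of steps applies: if d vanishes
  up to n \<delta>, its derivative vanishes from \<delta> to (n + 1) \<delta>.\<close>

lemma delay_equation_zero:
  fixes d :: "real \<Rightarrow> real"
  assumes "0 \<le> \<delta>" and init: "\<And>t. t \<in> {0..\<delta>} \<Longrightarrow> d t = 0"
    and deriv: "\<And>t. t \<in> {\<delta>..T} \<Longrightarrow> (d has_real_derivative k * d (t - \<delta>)) (at t within {\<delta>..T})"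
    and "t \<in> {0..T}"
  shows "d t = 0"
proof (cases "\<delta> = 0")
  case True
  have "((\<lambda>t. d t * exp (- k * t)) has_real_derivative 0) (at s within {0..T})" if "s \<in> {0..T}" for s
    using deriv[of s] that True by (auto intro!: derivative_eq_intros simp: algebra_simps)
  then obtain c where c: "\<And>s. s \<in> {0..T} \<Longrightarrow> d s * exp (- k * s) = c"
    using has_field_derivative_zero_constant[of "{0..T}" "\<lambda>t. d t * exp (- k * t)"] by auto
  then show ?thesis
    using c[of 0] c[of t] init[of 0] True assms(4) by auto
next
  case False
  then have \<delta>: "0 < \<delta>" using assms by simp
  have *: "\<forall>s\<in>{0..T}. s \<le> real n * \<delta> \<longrightarrow> d s = 0" for n
  proof (induction n)
    case 0
    then show ?case using init \<delta> by auto
  next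
    case (Suc n)
    show ?case
    proof safe
      fix s assume s: "s \<in> {0..T}" "s \<le> real (Suc n) * \<delta>"
      show "d s = 0"
      proof (cases "s \<le> \<delta>")
        case True
        then show ?thesis using s init by auto
      next
        case False
        have "(d has_real_derivative 0) (at u within {\<delta>..s})" if "u \<in> {\<delta>..s}" for u
        proof -
          have "d (u - \<delta>) = 0"
            using Suc s that \<delta> by (auto simp: algebra_simps)
          then show ?thesis
            using deriv[of u] that s by (auto intro: DERIV_subset)
        qed
        then obtain c where "\<And>u. u \<in> {\<delta>..s} \<Longrightarrow> d u = c"
          using has_field_derivative_zero_constant[of "{\<delta>..s}" d] by auto
        from this[of \<delta>] this[of s] show ?thesis
          using init[of \<delta>] \<delta> False by auto
      qed
    qed
  qed
  obtain N :: nat where "t / \<delta> < N" using reals_Archimedean2 by blast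
  then show ?thesis using *[of N] assms(4) \<delta> by (auto simp: field_simps)
qed

subsection \<open>The parameter \<open>\<alpha>\<close>\<close>

lemma shifted_mult_strict_mono:
  fixes f :: "real \<Rightarrow> real"
  assumes "mono_on {1..} f" "\<And>x. 1 \<le> x \<Longrightarrow> 1 \<le> f x" "1 \<le> x" "x < y"
  shows "(x - 1) * f x < (y - 1) * f y"
proof -
  have "(x - 1) * f x \<le> (x - 1) * f y"
    using assms by (intro mult_left_mono mono_onD[OF assms(1)]) auto
  also have "\<dots> < (y - 1) * f y"
    using assms(2)[of y] assms(3,4) by (intro mult_strict_right_mono) auto
  finally show ?thesis .
qed

lemma shifted_mult_le_imp_le:
  fixes f :: "real \<Rightarrow> real"
  assumes "mono_on {1..} f" "\<And>x. 1 \<le> x \<Longrightarrow> 1 \<le> f x" "1 \<le> y" "(x - 1) * f x \<le> (y - 1) * f y"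
  shows "x \<le> y"
  using shifted_mult_strict_mono[OF assms(1,2), of y x] assms(3,4) by force

text \<open>Serves twice, with c = \<theta> - 1: for \<open>alpha\<close>, f is the delayed
  exponential at time 1 as a function of a; for \<open>r_bar\<close>, f is
  \<open>r_bar_factor\<close>.\<close>

lemma ex1_shifted_mult_eq:
  fixes f :: "real \<Rightarrow> real"
  assumes "continuous_on {1..} f" "mono_on {1..} f" "\<And>x. 1 \<le> x \<Longrightarrow> 1 \<le> f x" "0 \<le> c"
  shows "\<exists>!x. 1 \<le> x \<and> (x - 1) * f x = c"
proof (rule ex_ex1I)
  \<comment> \<open>Since f \<ge> 1, the left-hand side goes from 0 at x = 1 to at least c at x = 1
    + c.\<close>
  have "\<exists>x\<ge>1. x \<le> 1 + c \<and> (x - 1) * f x = c"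
  proof (rule IVT')
    show "c \<le> (1 + c - 1) * f (1 + c)"
      using mult_left_mono[OF assms(3)[of "1 + c"] assms(4)] assms(4) by simp
    show "continuous_on {1..1 + c} (\<lambda>x. (x - 1) * f x)"
      by (intro continuous_intros continuous_on_subset[OF assms(1)]) auto
  qed (use assms in auto)
  then show "\<exists>x. 1 \<le> x \<and> (x - 1) * f x = c" by blast
  fix x y assume "1 \<le> x \<and> (x - 1) * f x = c" "1 \<le> y \<and> (y - 1) * f y = c"
  then show "x = y"
    using shifted_mult_le_imp_le[OF assms(2,3), of x y] shifted_mult_le_imp_le[OF assms(2,3), of y x]
    by auto
qed

text \<open>Trades the delay equation for a closed formula and one scalar equation in a. Forwards,
  the range condition at t = 0 gives a L \<ge> L, and \<phi> minus the formula solves the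
  homogeneous equation. Backwards, the formula stays in [L, U] because it is at least L and
  increases to U.\<close>

lemma threshold_curve_iff:
  assumes "0 < L" "L \<le> U" "0 \<le> \<delta>" "\<delta> < 1"
  shows "threshold_curve L U \<delta> a \<phi> \<longleftrightarrow>
    1 \<le> a \<and> (a - 1) * delay_exp \<delta> (a / (1 - \<delta>)) 1 = U / L - 1 \<and>
    (\<forall>t\<in>{0..1}. \<phi> t = L * (1 + (a - 1) * delay_exp \<delta> (a / (1 - \<delta>)) t))"
    (is "?lhs \<longleftrightarrow> ?rhs")
proof -
  define k where "k = a / (1 - \<delta>)"
  define \<psi> where "\<psi> t = L * (1 + (a - 1) * delay_exp \<delta> k t)" for t
  have init: "\<psi> t = a * L" if "t \<in> {0..\<delta>}" for t
    using that by (simp add: \<psi>_def delay_exp_initial)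
  have deriv: "(\<psi> has_real_derivative k * (\<psi> (t - \<delta>) - L)) (at t within {\<delta>..1})"
    if "t \<in> {\<delta>..1}" for t
    unfolding \<psi>_def using that assms
    by (auto intro!: derivative_eq_intros delay_exp_has_derivative simp: algebra_simps)
  have end_iff: "\<psi> 1 = U \<longleftrightarrow> (a - 1) * delay_exp \<delta> k 1 = U / L - 1"
    unfolding \<psi>_def using assms by (auto simp: field_simps)
  show ?thesis
    unfolding k_def[symmetric] \<psi>_def[symmetric]
  proof
    assume lhs: ?lhs
    then have range: "\<And>t. t \<in> {0..1} \<Longrightarrow> \<phi> t \<in> {L..U}"
      and \<phi>_init: "\<And>t. t \<in> {0..\<delta>} \<Longrightarrow> \<phi> t = a * L"
      and \<phi>_deriv: "\<And>t. t \<in> {\<delta>..1} \<Longrightarrow>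
        (\<phi> has_real_derivative k * (\<phi> (t - \<delta>) - L)) (at t within {\<delta>..1})"
      and "\<phi> 1 = U"
      using assms by (auto simp: threshold_curve_def k_def)
    have "1 \<le> a" using range[of 0] \<phi>_init[of 0] assms by auto
    moreover have eq: "\<phi> t = \<psi> t" if "t \<in> {0..1}" for t
    proof -
      have "\<phi> t - \<psi> t = 0"
      proof (rule delay_equation_zero[where d = "\<lambda>t. \<phi> t - \<psi> t", OF \<open>0 \<le> \<delta>\<close>])
        fix s assume s: "s \<in> {\<delta>..1}"
        show "((\<lambda>t. \<phi> t - \<psi> t) has_real_derivative k * (\<phi> (s - \<delta>) - \<psi> (s - \<delta>))) (at s within {\<delta>..1})"
          using DERIV_diff[OF \<phi>_deriv[OF s] deriv[OF s]] by (simp add: algebra_simps)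
      qed (use that init \<phi>_init in auto)
      then show ?thesis by simp
    qed
    moreover have "\<psi> 1 = U" using eq[of 1] \<open>\<phi> 1 = U\<close> by simp
    ultimately show "1 \<le> a \<and> (a - 1) * delay_exp \<delta> k 1 = U / L - 1 \<and> (\<forall>t\<in>{0..1}. \<phi> t = \<psi> t)"
      using end_iff by blast
  next
    assume rhs: "1 \<le> a \<and> (a - 1) * delay_exp \<delta> k 1 = U / L - 1 \<and> (\<forall>t\<in>{0..1}. \<phi> t = \<psi> t)"
    then have eq: "\<And>t. t \<in> {0..1} \<Longrightarrow> \<phi> t = \<psi> t" and "1 \<le> a" and \<psi>1: "\<psi> 1 = U"
      using end_iff by auto
    then have k: "0 \<le> k" using assms by (simp add: k_def)
    have "\<psi> t \<in> {L..U}" if "t \<in> {0..1}" for t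
    proof -
      have "0 \<le> (a - 1) * delay_exp \<delta> k t"
        using delay_exp_ge_1[OF k \<open>0 \<le> \<delta>\<close>, of t] \<open>1 \<le> a\<close> by auto
      then have "L \<le> \<psi> t"
        using \<open>0 < L\<close> by (simp add: \<psi>_def)
      moreover have "\<psi> t \<le> \<psi> 1"
        using that \<open>1 \<le> a\<close> assms k unfolding \<psi>_def
        by (intro mult_left_mono add_left_mono delay_exp_mono) auto
      ultimately show ?thesis using \<psi>1 by simp
    qed
    moreover have "(\<phi> has_real_derivative k * (\<phi> (t - \<delta>) - L)) (at t within {\<delta>..1})"
      if t: "t \<in> {\<delta>..1}" for t
    proof -
      have "(\<phi> has_real_derivative k * (\<psi> (t - \<delta>) - L)) (at t within {\<delta>..1})"
        by (rule has_field_derivative_transform_within[OF deriv[OF t], of 1])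
           (use t eq assms in auto)
      then show ?thesis using eq[of "t - \<delta>"] t assms by simp
    qed
    ultimately show ?lhs
      using assms eq init \<psi>1 unfolding threshold_curve_def k_def[symmetric] by auto
  qed
qed

lemma delay_exp_parameter_mono_on:
  assumes "0 \<le> \<delta>" "\<delta> < 1"
  shows "mono_on {1..} (\<lambda>a. delay_exp \<delta> (a / (1 - \<delta>)) 1)"
  using assms by (auto intro!: mono_onI delay_exp_mono divide_right_mono)

lemma alpha_ex1:
  assumes "1 \<le> \<theta>" "0 \<le> \<delta>" "\<delta> < 1"
  shows "\<exists>!a. 1 \<le> a \<and> (a - 1) * delay_exp \<delta> (a / (1 - \<delta>)) 1 = \<theta> - 1"
proof (rule ex1_shifted_mult_eq)
  show "continuous_on {1..} (\<lambda>a. delay_exp \<delta> (a / (1 - \<delta>)) 1)"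
    by (rule continuous_on_compose2[OF continuous_on_delay_exp_parameter[of \<delta> 1 UNIV]])
       (use assms in \<open>auto intro!: continuous_intros\<close>)
qed (use assms in \<open>auto intro!: delay_exp_parameter_mono_on delay_exp_ge_1\<close>)

text \<open>The scalar equation sees L and U only through \<theta>, so a curve for a given solution
  a can be exhibited with L = 1 and U = \<theta>.\<close>

lemma alpha_eq_The:
  assumes "1 \<le> \<theta>" "0 \<le> \<delta>" "\<delta> < 1"
  shows "alpha \<theta> \<delta> = (THE a. 1 \<le> a \<and> (a - 1) * delay_exp \<delta> (a / (1 - \<delta>)) 1 = \<theta> - 1)"
proof -
  have "(\<exists>L U \<phi>. 0 < L \<and> L \<le> U \<and> \<theta> = U / L \<and> threshold_curve L U \<delta> a \<phi>) \<longleftrightarrow>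
      1 \<le> a \<and> (a - 1) * delay_exp \<delta> (a / (1 - \<delta>)) 1 = \<theta> - 1" (is "?lhs \<longleftrightarrow> ?rhs") for a
  proof
    assume ?lhs
    then show ?rhs using threshold_curve_iff assms by auto
  next
    assume ?rhs
    then have "threshold_curve 1 \<theta> \<delta> a (\<lambda>t. 1 * (1 + (a - 1) * delay_exp \<delta> (a / (1 - \<delta>)) t))"
      using assms by (subst threshold_curve_iff) auto
    then show ?lhs using assms by (intro exI[of _ 1] exI[of _ \<theta>]) auto
  qed
  then show ?thesis by (simp add: alpha_def)
qed

lemma alpha_eqn:
  assumes "1 \<le> \<theta>" "0 \<le> \<delta>" "\<delta> < 1"
  shows "1 \<le> alpha \<theta> \<delta>"
    and "(alpha \<theta> \<delta> - 1) * delay_exp \<delta> (alpha \<theta> \<delta> / (1 - \<delta>)) 1 = \<theta> - 1"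
  using theI'[OF alpha_ex1[OF assms]] unfolding alpha_eq_The[OF assms] by auto

lemma alpha_unique:
  assumes "1 \<le> \<theta>" "0 \<le> \<delta>" "\<delta> < 1" "1 \<le> a" "(a - 1) * delay_exp \<delta> (a / (1 - \<delta>)) 1 = \<theta> - 1"
  shows "alpha \<theta> \<delta> = a"
  using alpha_ex1[OF assms(1-3)] alpha_eqn[OF assms(1-3)] assms by blast

lemma alpha_1: "1 \<le> \<theta> \<Longrightarrow> alpha \<theta> 1 = sqrt \<theta>"
  unfolding alpha_def
proof (rule the_equality)
  assume "1 \<le> \<theta>"
  then have "sqrt \<theta> \<le> \<theta>"
    using mult_left_mono[of 1 "sqrt \<theta>" "sqrt \<theta>"] by simp
  then have "threshold_curve 1 \<theta> 1 (sqrt \<theta>) (\<lambda>_. sqrt \<theta>)"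
    using \<open>1 \<le> \<theta>\<close> by (auto simp: threshold_curve_def)
  then show "\<exists>L U \<phi>. 0 < L \<and> L \<le> U \<and> \<theta> = U / L \<and> threshold_curve L U 1 (sqrt \<theta>) \<phi>"
    using \<open>1 \<le> \<theta>\<close> by (intro exI[of _ 1] exI[of _ \<theta>]) auto
qed (auto simp: threshold_curve_def)

subsection \<open>The upper bound on \<open>\<alpha>\<close>\<close>

text \<open>Brings the equation of \<open>r_bar\<close> into the form (r - 1) f r = \<theta> - 1.
  The exponential at \<delta> = 0 has to be stipulated, because 1 / 0 = 0 gives
  \<open>n_bar 0 = 1\<close>.\<close>

definition r_bar_factor :: "real \<Rightarrow> real \<Rightarrow> real" where
  "r_bar_factor \<delta> r = (if \<delta> = 0 then exp r else (1 + r / real (n_bar \<delta>)) ^ n_bar \<delta>)"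

lemma r_bar_equation_iff: "r_bar_equation \<theta> \<delta> r \<longleftrightarrow> (r - 1) * r_bar_factor \<delta> r = \<theta> - 1"
  by (simp add: r_bar_equation_def r_bar_factor_def)

lemma n_bar_pos: "0 < n_bar \<delta>"
  by (simp add: n_bar_def)

lemma n_bar_neq_0 [simp]: "n_bar \<delta> \<noteq> 0"
  using n_bar_pos[of \<delta>] by simp

lemma r_bar_factor_ge_1: "0 \<le> r \<Longrightarrow> 1 \<le> r_bar_factor \<delta> r"
  by (auto simp: r_bar_factor_def intro!: one_le_power)

lemma r_bar_factor_mono_on: "mono_on {1..} (r_bar_factor \<delta>)"
  by (auto simp: r_bar_factor_def intro!: mono_onI power_mono divide_right_mono)

lemma r_bar_equation_ex1_ge_1:
  assumes "1 \<le> \<theta>"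
  shows "\<exists>!r. 1 \<le> r \<and> r_bar_equation \<theta> \<delta> r"
  unfolding r_bar_equation_iff
proof (rule ex1_shifted_mult_eq)
  show "continuous_on {1..} (r_bar_factor \<delta>)"
    by (cases "\<delta> = 0") (auto simp: r_bar_factor_def[abs_def] intro!: continuous_intros)
qed (use assms in \<open>auto intro: r_bar_factor_mono_on r_bar_factor_ge_1\<close>)

text \<open>For 0 < r < 1 the left-hand side is negative, but \<theta> - 1 \<ge> 0. This links
  positivity to the domain \<open>{1..}\<close> of the monotonicity argument.\<close>

lemma r_bar_equation_pos_imp_ge_1:
  assumes "1 \<le> \<theta>" "0 < r" "r_bar_equation \<theta> \<delta> r"
  shows "1 \<le> r"
proof (rule ccontr)
  assume "\<not> 1 \<le> r"
  then have "(r - 1) * r_bar_factor \<delta> r < 0"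
    using r_bar_factor_ge_1[of r \<delta>] assms by (intro mult_neg_pos) auto
  then show False using assms by (simp add: r_bar_equation_iff)
qed

lemma r_bar_equation_ex1:
  assumes "1 \<le> \<theta>"
  shows "\<exists>!r. 0 < r \<and> r_bar_equation \<theta> \<delta> r"
  using r_bar_equation_ex1_ge_1[OF assms] r_bar_equation_pos_imp_ge_1[OF assms]
  by (metis less_le_trans zero_less_one)

lemma r_bar_eqn:
  assumes "1 \<le> \<theta>"
  shows "1 \<le> r_bar \<theta> \<delta>" "(r_bar \<theta> \<delta> - 1) * r_bar_factor \<delta> (r_bar \<theta> \<delta>) = \<theta> - 1"
  using theI'[OF r_bar_equation_ex1[OF assms, of \<delta>]] r_bar_equation_pos_imp_ge_1[OF assms]
  unfolding r_bar_def[symmetric] by (auto simp: r_bar_equation_iff)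

lemma r_bar_unique:
  assumes "1 \<le> \<theta>" "0 < r" "(r - 1) * r_bar_factor \<delta> r = \<theta> - 1"
  shows "r_bar \<theta> \<delta> = r"
  unfolding r_bar_def
  using r_bar_equation_ex1[OF assms(1), of \<delta>] assms(2,3)
  by (intro the1_equality) (auto simp: r_bar_equation_iff)

lemma r_bar_le_theta:
  assumes "1 \<le> \<theta>"
  shows "r_bar \<theta> \<delta> \<le> \<theta>"
  using r_bar_eqn[OF assms, of \<delta>]
    mult_left_mono[OF r_bar_factor_ge_1[of "r_bar \<theta> \<delta>" \<delta>], of "r_bar \<theta> \<delta> - 1"]
  by auto

text \<open>Here \<lfloor>1 / \<delta>\<rfloor> \<le> 4, so \<open>n_bar\<close> has its least value
  1 and the equation reads (r - 1) (1 + r) = \<theta> - 1.\<close>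

lemma r_bar_eq_sqrt:
  assumes "1 \<le> \<theta>" "1 / 5 < \<delta>"
  shows "r_bar \<theta> \<delta> = sqrt \<theta>"
proof (rule r_bar_unique)
  have "1 / \<delta> < 5" using assms by (simp add: field_simps)
  then have "\<lfloor>1 / \<delta>\<rfloor> \<le> 4" by linarith
  then have "\<lfloor>(real_of_int \<lfloor>1 / \<delta>\<rfloor> - 1) / 2\<rfloor> \<le> 1"
    by (simp add: floor_le_iff)
  then have "n_bar \<delta> = 1" by (simp add: n_bar_def)
  then show "(sqrt \<theta> - 1) * r_bar_factor \<delta> (sqrt \<theta>) = \<theta> - 1"
    using assms by (simp add: r_bar_factor_def algebra_simps)
qed (use assms in auto)

text \<open>AM-GM: the factors pair up as \<open>i\<close> and \<open>j - 1 - i\<close>, with constant mean.\<close>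

lemma prod_one_minus_le_power:
  assumes "j \<le> n"
  shows "(\<Prod>i<j. 1 - real i / real n) \<le> (1 - (real j - 1) / (2 * real n)) ^ j"
    (is "?P \<le> ?m ^ j")
proof (cases "j = 0")
  case False
  then have n: "0 < n" using assms by simp
  have m: "0 \<le> ?m" using assms n by (simp add: field_simps)
  have "?P ^ 2 = ?P * (\<Prod>i<j. 1 - real (j - Suc i) / real n)"
    by (simp only: prod.nat_diff_reindex[of "\<lambda>i. 1 - real i / real n"] power2_eq_square)
  also have "\<dots> = (\<Prod>i<j. (1 - real i / real n) * (1 - real (j - Suc i) / real n))"
    by (simp add: prod.distrib)
  also have "\<dots> \<le> (\<Prod>i<j. ?m ^ 2)"
  proof (rule prod_mono, intro conjI)
    fix i assume i: "i \<in> {..<j}"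
    then show "0 \<le> (1 - real i / real n) * (1 - real (j - Suc i) / real n)"
      using assms n by (intro mult_nonneg_nonneg) (auto simp: field_simps)
    \<comment> \<open>The square of the mean of two numbers exceeds their product by the square of
      half their difference.\<close>
    have "?m ^ 2 - (1 - real i / real n) * (1 - real (j - Suc i) / real n)
        = ((real i / real n - real (j - Suc i) / real n) / 2) ^ 2"
      using i n by (simp add: of_nat_diff power2_eq_square field_simps)
    then show "(1 - real i / real n) * (1 - real (j - Suc i) / real n) \<le> ?m ^ 2"
      using zero_le_power2[of "(real i / real n - real (j - Suc i) / real n) / 2"] by linarith
  qed
  also have "\<dots> = (?m ^ j) ^ 2"
    by (simp add: power_mult[symmetric] mult.commute)
  finally show ?thesis using m by (auto intro: power2_le_imp_le)
qed simp

section \<open>Binomial coefficients against the terms of the delayed exponential\<close>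

lemma binomial_div_power_eq_prod:
  assumes "0 < n"
  shows "real (n choose j) / real n ^ j = (\<Prod>i<j. 1 - real i / real n) / fact j"
proof -
  have "real (n choose j) = (\<Prod>i<j. real n - real i) / fact j"
    by (simp add: binomial_gbinomial gbinomial_prod_rev atLeast0LessThan)
  also have "(\<Prod>i<j. real n - real i) = (\<Prod>i<j. real n * (1 - real i / real n))"
    using assms by (intro prod.cong) (auto simp: field_simps)
  also have "\<dots> = real n ^ j * (\<Prod>i<j. 1 - real i / real n)"
    by (simp add: prod.distrib)
  finally show ?thesis using assms by simp
qed

text \<open>After AM-GM it remains to see that 1 - (j - 1) / (2 n) \<le> (1 - j \<delta>) / (1 -
  \<delta>). For j > 1 this is equivalent to \<delta> (2 n + 1) \<le> 1, the condition that dictates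
  the choice of \<open>n_bar\<close>.\<close>

lemma binomial_div_power_le:
  assumes "0 < n" "j \<le> n" "0 \<le> \<delta>" "\<delta> * (2 * real n + 1) \<le> 1"
  shows "real (n choose j) / real n ^ j \<le> (max 0 (1 - real j * \<delta>) / (1 - \<delta>)) ^ j / fact j"
proof (cases "j = 0")
  case False
  have "\<delta> * 3 \<le> \<delta> * (2 * real n + 1)"
    using assms by (intro mult_left_mono) auto
  then have \<delta>: "\<delta> < 1" using assms by simp
  have "(1 - (real j - 1) / (2 * real n)) * (1 - \<delta>) \<le> 1 - real j * \<delta>"
  proof -
    have "(real j - 1) * (\<delta> * (2 * real n + 1)) \<le> (real j - 1) * 1"
      using False assms by (intro mult_left_mono) auto
    then have "(2 * real n - (real j - 1)) * (1 - \<delta>) \<le> 2 * real n * (1 - real j * \<delta>)"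
      by (simp add: algebra_simps)
    then show ?thesis using assms by (simp add: field_simps)
  qed
  then have "1 - (real j - 1) / (2 * real n) \<le> max 0 (1 - real j * \<delta>) / (1 - \<delta>)"
    using \<delta> by (simp add: field_simps max_def)
  moreover have "0 \<le> 1 - (real j - 1) / (2 * real n)"
    using assms by (simp add: field_simps)
  ultimately have "(1 - (real j - 1) / (2 * real n)) ^ j \<le> (max 0 (1 - real j * \<delta>) / (1 - \<delta>)) ^ j"
    by (intro power_mono)
  then show ?thesis
    unfolding binomial_div_power_eq_prod[OF assms(1)]
    using prod_one_minus_le_power[OF assms(2)] by (intro divide_right_mono) auto
qed simp

text \<open>\<open>n_bar \<delta>\<close> is the largest n with \<delta> (2 n + 1) \<le> 1 if that n
  is positive. Otherwise the maximum with 1 takes over, and the inequality may fail.\<close>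

lemma n_bar_cases:
  assumes "0 < \<delta>"
  obtains "n_bar \<delta> = 1" | "\<delta> * (2 * real (n_bar \<delta>) + 1) \<le> 1"
proof (cases "n_bar \<delta> = 1")
  case False
  then have "int (n_bar \<delta>) = \<lfloor>(real_of_int \<lfloor>1 / \<delta>\<rfloor> - 1) / 2\<rfloor>"
    by (auto simp: n_bar_def max_def split: if_splits)
  then have "real (n_bar \<delta>) \<le> (real_of_int \<lfloor>1 / \<delta>\<rfloor> - 1) / 2"
    by (metis of_int_floor_le of_int_of_nat_eq)
  then have "2 * real (n_bar \<delta>) + 1 \<le> real_of_int \<lfloor>1 / \<delta>\<rfloor>"
    by (simp add: field_simps)
  also have "\<dots> \<le> 1 / \<delta>" by (rule of_int_floor_le)
  finally have "2 * real (n_bar \<delta>) + 1 \<le> 1 / \<delta>" .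
  then show ?thesis using that assms by (simp add: field_simps)
qed

lemma r_bar_factor_le_delay_exp:
  assumes "0 \<le> \<delta>" "\<delta> < 1" "0 \<le> a"
  shows "r_bar_factor \<delta> a \<le> delay_exp \<delta> (a / (1 - \<delta>)) 1"
proof (cases "\<delta> = 0")
  case True
  then show ?thesis by (simp add: r_bar_factor_def delay_exp_no_delay)
next
  case False
  then have "0 < \<delta>" using assms by simp
  then show ?thesis
  proof (cases rule: n_bar_cases)
    case 1
    \<comment> \<open>For n = 1 the target is 1 + a, which the first two terms give exactly: the
      factor 1 - \<delta> cancels in the term j = 1.\<close>
    have "1 + a = (\<Sum>j\<le>1. (a / (1 - \<delta>)) ^ j * max 0 (1 - real j * \<delta>) ^ j / fact j)"
      using assms by (simp add: max_def)
    also have "\<dots> \<le> delay_exp \<delta> (a / (1 - \<delta>)) 1"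
      using assms by (intro sum_le_delay_exp) auto
    finally show ?thesis using 1 False by (simp add: r_bar_factor_def)
  next
    case 2
    let ?n = "n_bar \<delta>"
    have "r_bar_factor \<delta> a = (\<Sum>j\<le>?n. real (?n choose j) / real ?n ^ j * a ^ j)"
      using False binomial_ring[of "a / real ?n" 1 ?n]
      by (simp add: r_bar_factor_def add.commute power_divide)
    also have "\<dots> \<le> (\<Sum>j\<le>?n. (max 0 (1 - real j * \<delta>) / (1 - \<delta>)) ^ j / fact j * a ^ j)"
      using assms 2 n_bar_pos by (intro sum_mono mult_right_mono binomial_div_power_le) auto
    also have "\<dots> = (\<Sum>j\<le>?n. (a / (1 - \<delta>)) ^ j * max 0 (1 - real j * \<delta>) ^ j / fact j)"
      by (intro sum.cong) (auto simp: power_divide)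
    also have "\<dots> \<le> delay_exp \<delta> (a / (1 - \<delta>)) 1"
      using assms by (intro sum_le_delay_exp) auto
    finally show ?thesis .
  qed
qed

text \<open>A larger factor forces a smaller root: \<open>delay_exp\<close> dominates
  \<open>r_bar_factor\<close>, and both products equal \<theta> - 1. At \<delta> = 1, where the
  parameter is fixed by definition, both sides are the square root.\<close>

lemma alpha_le_r_bar:
  assumes "1 \<le> \<theta>" "0 \<le> \<delta>" "\<delta> \<le> 1"
  shows "alpha \<theta> \<delta> \<le> r_bar \<theta> \<delta>"
proof (cases "\<delta> = 1")
  case True
  then show ?thesis using assms alpha_1 r_bar_eq_sqrt by simp
next
  case False
  then have \<delta>: "\<delta> < 1" using assms by simp
  note a = alpha_eqn[OF assms(1,2) \<delta>] and r = r_bar_eqn[OF assms(1), of \<delta>]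
  show ?thesis
  proof (rule shifted_mult_le_imp_le[OF r_bar_factor_mono_on[of \<delta>]])
    show "(alpha \<theta> \<delta> - 1) * r_bar_factor \<delta> (alpha \<theta> \<delta>)
        \<le> (r_bar \<theta> \<delta> - 1) * r_bar_factor \<delta> (r_bar \<theta> \<delta>)"
      unfolding r(2) a(2)[symmetric]
      using a(1) assms \<delta> by (intro mult_left_mono r_bar_factor_le_delay_exp) auto
  qed (use r in \<open>auto intro: r_bar_factor_ge_1\<close>)
qed

text \<open>For \<delta> < 1 the series at time 1 stops after j = 1, as 1 - 2 \<delta> \<le> 0. It
  equals 1 + a, and (a - 1) (1 + a) = \<theta> - 1.\<close>

lemma alpha_eq_sqrt:
  assumes "1 \<le> \<theta>" "1 / 2 \<le> \<delta>" "\<delta> \<le> 1"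
  shows "alpha \<theta> \<delta> = sqrt \<theta>"
proof (cases "\<delta> = 1")
  case True
  then show ?thesis using assms alpha_1 by simp
next
  case False
  have "delay_exp \<delta> (sqrt \<theta> / (1 - \<delta>)) 1 = 1 + sqrt \<theta>"
    using assms False delay_exp_eq_sum[of 1 2 \<delta> "sqrt \<theta> / (1 - \<delta>)"]
    by (simp add: numeral_2_eq_2 max_def)
  then show ?thesis
    using assms False by (intro alpha_unique) (auto simp: algebra_simps)
qed

section \<open>Behaviour of \<open>r_bar\<close> as \<delta> tends to 0\<close>

lemma exp_sub_le_one_plus_div_power:
  fixes r :: real
  assumes "0 < n" "0 \<le> r"
  shows "exp (r - r\<^sup>2 / real n) \<le> (1 + r / real n) ^ n"
proof (cases "r \<le> real n")
  case True
  \<comment> \<open>The claim is the n-th power of exp (x - x^2) \<le> 1 + x, valid at x = r / n in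
    [0, 1].\<close>
  have "r / real n - (r / real n)\<^sup>2 \<le> ln (1 + r / real n)"
    using assms True by (intro ln_one_plus_pos_lower_bound) auto
  then have "exp (r / real n - (r / real n)\<^sup>2) \<le> 1 + r / real n"
    using assms by (simp add: add_pos_nonneg ln_ge_iff)
  then have "exp (r / real n - (r / real n)\<^sup>2) ^ n \<le> (1 + r / real n) ^ n"
    by (intro power_mono) auto
  moreover have "real n * (r / real n - (r / real n)\<^sup>2) = r - r\<^sup>2 / real n"
    using assms by (simp add: field_simps power2_eq_square)
  ultimately show ?thesis by (simp add: exp_of_nat_mult[symmetric])
next
  case False
  then have "r * real n \<le> r * r" using assms by (intro mult_left_mono) auto
  then have "r - r\<^sup>2 / real n \<le> 0"
    using assms by (simp add: field_simps power2_eq_square)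
  then have "exp (r - r\<^sup>2 / real n) \<le> 1" by simp
  also have "1 \<le> (1 + r / real n) ^ n" using assms by (intro one_le_power) auto
  finally show ?thesis .
qed

text \<open>As (1 + r / n)^n \<le> exp r, the root r for \<delta> satisfies (r - 1) exp r \<ge>
  \<theta> - 1, so it lies above the root for 0.\<close>

lemma r_bar_0_le:
  assumes "1 \<le> \<theta>"
  shows "r_bar \<theta> 0 \<le> r_bar \<theta> \<delta>"
proof -
  note r = r_bar_eqn[OF assms, of \<delta>] and s = r_bar_eqn[OF assms, of 0]
  have "r_bar_factor \<delta> (r_bar \<theta> \<delta>) \<le> exp (r_bar \<theta> \<delta>)"
    using exp_ge_one_plus_x_over_n_power_n[of "n_bar \<delta>" "r_bar \<theta> \<delta>"] r(1) n_bar_pos[of \<delta>]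
    by (simp add: r_bar_factor_def)
  then have "(r_bar \<theta> \<delta> - 1) * r_bar_factor \<delta> (r_bar \<theta> \<delta>) \<le> (r_bar \<theta> \<delta> - 1) * r_bar_factor 0 (r_bar \<theta> \<delta>)"
    using r(1) by (intro mult_left_mono) (auto simp: r_bar_factor_def)
  then have "(r_bar \<theta> 0 - 1) * r_bar_factor 0 (r_bar \<theta> 0) \<le> (r_bar \<theta> \<delta> - 1) * r_bar_factor 0 (r_bar \<theta> \<delta>)"
    unfolding r(2) s(2) .
  then show ?thesis
    by (rule shifted_mult_le_imp_le[OF r_bar_factor_mono_on, rotated 2])
       (use r(1) in \<open>simp_all add: r_bar_factor_ge_1\<close>)
qed

text \<open>A perturbation estimate: at r = \<open>r_bar \<theta> \<delta>\<close>, the value (r -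
  1) exp r exceeds \<theta> - 1 by a factor of at most exp (\<theta>^2 / n), and this excess
  controls the distance of the roots.\<close>

lemma r_bar_upper_bound:
  assumes "1 \<le> \<theta>" "0 < \<delta>" "\<theta>\<^sup>2 / real (n_bar \<delta>) \<le> 1"
  shows "r_bar \<theta> \<delta> \<le> r_bar \<theta> 0 + 2 * \<theta> ^ 3 / real (n_bar \<delta>)"
proof -
  define n r s where "n = real (n_bar \<delta>)" and "r = r_bar \<theta> \<delta>" and "s = r_bar \<theta> 0"
  note r = r_bar_eqn[OF assms(1), of \<delta>, folded r_def]
  note s = r_bar_eqn[OF assms(1), of 0, folded s_def]
  have n: "0 < n" "\<theta>\<^sup>2 / n \<le> 1" using n_bar_pos assms by (auto simp: n_def)
  have "s \<le> r" using r_bar_0_le[OF assms(1)] by (simp add: r_def s_def)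
  \<comment> \<open>The crude bound r \<le> \<theta> makes the error exponent independent of
    r.\<close>
  have "r\<^sup>2 / n \<le> \<theta>\<^sup>2 / n"
    using r r_bar_le_theta[OF assms(1), of \<delta>] n by (intro divide_right_mono power_mono) (auto simp: r_def)
  then have "exp (r - \<theta>\<^sup>2 / n) \<le> exp (r - r\<^sup>2 / n)" by simp
  also have "\<dots> \<le> r_bar_factor \<delta> r"
    using exp_sub_le_one_plus_div_power[of "n_bar \<delta>" r] r n_bar_pos assms
    by (simp add: r_bar_factor_def n_def)
  finally have "(r - 1) * exp (r - \<theta>\<^sup>2 / n) \<le> \<theta> - 1"
    using r by (metis diff_ge_0_iff_ge mult_left_mono)
  then have "(r - 1) * exp (r - \<theta>\<^sup>2 / n) * exp (\<theta>\<^sup>2 / n) \<le> (\<theta> - 1) * exp (\<theta>\<^sup>2 / n)"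
    by (intro mult_right_mono) auto
  then have upper: "(r - 1) * exp r \<le> (\<theta> - 1) * exp (\<theta>\<^sup>2 / n)"
    by (simp add: exp_diff)
  \<comment> \<open>The chain bounds r - s by the increase of (x - 1) exp x from x = s to x =
    r.\<close>
  have "r - s \<le> (r - s) * exp s"
    using \<open>s \<le> r\<close> s(1) mult_left_mono[of 1 "exp s" "r - s"] by simp
  also have "\<dots> = (r - 1) * exp s - (\<theta> - 1)"
    using s(2) by (simp add: r_bar_factor_def algebra_simps)
  also have "\<dots> \<le> (r - 1) * exp r - (\<theta> - 1)"
    using \<open>s \<le> r\<close> r(1) by (intro diff_right_mono mult_left_mono) auto
  also have "\<dots> \<le> (\<theta> - 1) * (exp (\<theta>\<^sup>2 / n) - 1)"
    using upper by (simp add: algebra_simps)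
  also have "\<dots> \<le> (\<theta> - 1) * (2 * (\<theta>\<^sup>2 / n))"
  proof (intro mult_left_mono)
    \<comment> \<open>For 0 \<le> x \<le> 1, exp x \<le> 1 + x + x^2 and x^2 \<le> x.\<close>
    have "(\<theta>\<^sup>2 / n)\<^sup>2 \<le> \<theta>\<^sup>2 / n"
      unfolding power2_eq_square[of "\<theta>\<^sup>2 / n"] using n by (intro mult_left_le) auto
    then show "exp (\<theta>\<^sup>2 / n) - 1 \<le> 2 * (\<theta>\<^sup>2 / n)"
      using exp_bound[of "\<theta>\<^sup>2 / n"] n by (auto simp: less_imp_le)
  qed (use assms in auto)
  also have "\<dots> \<le> \<theta> * (2 * (\<theta>\<^sup>2 / n))"
    using n by (intro mult_right_mono) auto
  also have "\<dots> = 2 * \<theta> ^ 3 / n"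
    by (simp add: power2_eq_square power3_eq_cube)
  finally show ?thesis by (simp add: r_def s_def n_def)
qed

text \<open>Both floors together still leave \<open>n_bar \<delta>\<close> at least 1 / (2 \<delta>)
  - 2, and \<delta> \<le> 1 / 8 makes 2 at most 1 / (4 \<delta>).\<close>

lemma inverse_n_bar_le:
  assumes "0 < \<delta>" "\<delta> \<le> 1 / 8"
  shows "1 / real (n_bar \<delta>) \<le> 4 * \<delta>"
proof -
  have "real_of_int \<lfloor>(real_of_int \<lfloor>1 / \<delta>\<rfloor> - 1) / 2\<rfloor> \<le> real (n_bar \<delta>)"
    unfolding n_bar_def by (smt (verit) int_nat_eq of_int_le_iff of_int_of_nat_eq)
  moreover have "1 / \<delta> - 1 < real_of_int \<lfloor>1 / \<delta>\<rfloor>"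
    "(real_of_int \<lfloor>1 / \<delta>\<rfloor> - 1) / 2 - 1 < real_of_int \<lfloor>(real_of_int \<lfloor>1 / \<delta>\<rfloor> - 1) / 2\<rfloor>"
    by (rule real_of_int_floor_gt_diff_one)+
  ultimately have "1 / \<delta> / 2 - 2 \<le> real (n_bar \<delta>)"
    by (simp only: field_simps)
  moreover have "1 / \<delta> / 4 \<le> 1 / \<delta> / 2 - 2" using assms by (simp add: field_simps)
  ultimately have "1 / \<delta> / 4 \<le> real (n_bar \<delta>)" by (rule order_trans[rotated])
  then show ?thesis using assms n_bar_pos[of \<delta>] by (simp add: field_simps)
qed

lemma eventually_r_bar_upper_bound:
  assumes "1 \<le> \<theta>"
  shows "\<forall>\<^sub>F d in at_right 0. r_bar \<theta> d \<le> r_bar \<theta> 0 + 8 * \<theta> ^ 3 * d"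
proof -
  \<comment> \<open>The bound 1 / 8 is for \<open>inverse_n_bar_le\<close>. The other one yields
    \<theta>^2 / n \<le> 4 \<theta>^2 d \<le> 1, as \<open>r_bar_upper_bound\<close>
    demands.\<close>
  define \<epsilon> where "\<epsilon> = min (1 / 8) (1 / (4 * \<theta>\<^sup>2))"
  have \<epsilon>: "0 < \<epsilon>" using assms by (simp add: \<epsilon>_def)
  have "r_bar \<theta> d \<le> r_bar \<theta> 0 + 8 * \<theta> ^ 3 * d" if d: "0 < d" "d < \<epsilon>" for d
  proof -
    have inv: "1 / real (n_bar d) \<le> 4 * d"
      using d by (intro inverse_n_bar_le) (auto simp: \<epsilon>_def)
    have "\<theta>\<^sup>2 * (1 / real (n_bar d)) \<le> \<theta>\<^sup>2 * (4 * d)"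
      using inv by (intro mult_left_mono) auto
    also have "\<dots> \<le> 1" using d assms by (simp add: \<epsilon>_def field_simps)
    finally have "r_bar \<theta> d \<le> r_bar \<theta> 0 + 2 * \<theta> ^ 3 / real (n_bar d)"
      using assms d by (intro r_bar_upper_bound) auto
    moreover have "2 * \<theta> ^ 3 * (1 / real (n_bar d)) \<le> 2 * \<theta> ^ 3 * (4 * d)"
      using inv assms by (intro mult_left_mono) auto
    ultimately show ?thesis by simp
  qed
  then show ?thesis using \<epsilon> by (auto simp: eventually_at_right_field)
qed

text \<open>Confirms, by squeezing, that the separate clause for \<delta> = 0 is the limit of the
  others.\<close>

lemma r_bar_tendsto:
  assumes "1 \<le> \<theta>"
  shows "(r_bar \<theta> \<longlongrightarrow> r_bar \<theta> 0) (at_right 0)"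
proof (rule tendsto_sandwich[OF _ eventually_r_bar_upper_bound[OF assms] tendsto_const])
  have "((\<lambda>d. r_bar \<theta> 0 + 8 * \<theta> ^ 3 * d) \<longlongrightarrow> r_bar \<theta> 0 + 8 * \<theta> ^ 3 * 0) (at_right 0)"
    by (intro tendsto_intros)
  then show "((\<lambda>d. r_bar \<theta> 0 + 8 * \<theta> ^ 3 * d) \<longlongrightarrow> r_bar \<theta> 0) (at_right 0)" by simp
qed (simp add: r_bar_0_le assms)

lemma r_bar_0_eq_lambert_W0:
  assumes "1 \<le> \<theta>"
  shows "r_bar \<theta> 0 = 1 + lambert_W0 ((\<theta> - 1) / exp 1)"
proof -
  note r = r_bar_eqn[OF assms, of 0]
  have "lambert_W0 ((\<theta> - 1) / exp 1) = r_bar \<theta> 0 - 1"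
    unfolding lambert_W0_def
  proof (rule the_equality)
    show "- 1 \<le> r_bar \<theta> 0 - 1 \<and> (r_bar \<theta> 0 - 1) * exp (r_bar \<theta> 0 - 1) = (\<theta> - 1) / exp 1"
      using r by (simp add: r_bar_factor_def exp_diff)
    fix w assume w: "- 1 \<le> w \<and> w * exp w = (\<theta> - 1) / exp 1"
    \<comment> \<open>Since \<theta> \<ge> 1, every candidate w is nonnegative, so 1 + w is a
      positive root and uniqueness of \<open>r_bar\<close> applies.\<close>
    then have "0 \<le> w * exp w" using assms by simp
    then have "0 \<le> w" by (simp add: zero_le_mult_iff)
    moreover have "w * exp (1 + w) = \<theta> - 1"
      using w by (simp add: exp_add field_simps)
    ultimately have "r_bar \<theta> 0 = 1 + w"
      using assms by (intro r_bar_unique) (auto simp: r_bar_factor_def)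
    then show "w = r_bar \<theta> 0 - 1" by simp
  qed
  then show ?thesis by simp
qed

lemma alpha_asymptotics:
  assumes "1 \<le> \<theta>"
  shows "\<exists>g \<in> O[at_right 0](\<lambda>d. d).
    \<forall>\<^sub>F d in at_right 0. alpha \<theta> d \<le> 1 + lambert_W0 ((\<theta> - 1) / exp 1) + g d"
\<comment> \<open>The witness is left open here; the first \<open>show\<close> fixes it as g d = 8
  \<theta>^3 d.\<close>
proof (rule bexI)
  have "\<forall>\<^sub>F d in at_right 0. d \<in> {0<..<1 :: real}"
    by (rule eventually_at_right_real) simp
  with eventually_r_bar_upper_bound[OF assms]
  show "\<forall>\<^sub>F d in at_right 0. alpha \<theta> d \<le> 1 + lambert_W0 ((\<theta> - 1) / exp 1) + 8 * \<theta> ^ 3 * d"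
  proof eventually_elim
    case (elim d)
    then show ?case
      using alpha_le_r_bar[OF assms, of d] r_bar_0_eq_lambert_W0[OF assms] by auto
  qed
qed auto

subsection \<open>CVaR of the profit\<close>

text \<open>A collects the worst outcomes and q separates them from the rest; ties at q may lie on
  either side. For every t, the mean of (t - Y)^+ is at least the integral of t - Y over A, which
  bounds the supremum; at t = q this is an equality.\<close>

lemma (in prob_space) CVaR_eq_integral_lower_part:
  fixes Y :: "'a \<Rightarrow> real"
  assumes "\<delta> < 1" and Y: "integrable M Y" and A: "A \<in> sets M" "prob A = 1 - \<delta>"
    and lower: "\<And>x. x \<in> A \<Longrightarrow> Y x \<le> q"
    and upper: "\<And>x. x \<in> space M - A \<Longrightarrow> q \<le> Y x"
  shows "CVaR \<delta> M Y = (\<integral>x. indicator A x * Y x \<partial>M) / (1 - \<delta>)"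
proof -
  have int: "integrable M (\<lambda>x. indicator A x * Y x)"
    using Y A by (intro integrable_mult_indicator[where f = Y, simplified])
  have int_pos: "integrable M (\<lambda>x. max 0 (t - Y x))" for t
    using Y by (intro integrable_max) auto
  have shifted: "(\<integral>x. indicator A x * (t - Y x) \<partial>M)
      = (1 - \<delta>) * t - (\<integral>x. indicator A x * Y x \<partial>M)" for t
  proof -
    have "(\<integral>x. indicator A x * (t - Y x) \<partial>M) = (\<integral>x. indicator A x * t - indicator A x * Y x \<partial>M)"
      by (simp add: algebra_simps)
    also have "\<dots> = (\<integral>x. indicator A x * t \<partial>M) - (\<integral>x. indicator A x * Y x \<partial>M)"
      using A int by (intro Bochner_Integration.integral_diff) (auto simp: emeasure_eq_measure)
    finally show ?thesis using A by simp
  qed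
  have int_shifted: "integrable M (\<lambda>x. indicator A x * (t - Y x))" for t
    using Y A by (intro integrable_mult_indicator[where f = "\<lambda>x. t - Y x", simplified]) auto
  have "(SUP t. t - 1 / (1 - \<delta>) * (\<integral>x. max 0 (t - Y x) \<partial>M))
      = (\<integral>x. indicator A x * Y x \<partial>M) / (1 - \<delta>)"
  proof (rule cSup_eq_maximum)
    have "(\<integral>x. max 0 (q - Y x) \<partial>M) = (\<integral>x. indicator A x * (q - Y x) \<partial>M)"
    proof (rule Bochner_Integration.integral_cong)
      show "max 0 (q - Y x) = indicator A x * (q - Y x)" if "x \<in> space M" for x
        using lower[of x] upper[of x] that by (cases "x \<in> A") auto
    qed simp
    then have "(\<integral>x. indicator A x * Y x \<partial>M) / (1 - \<delta>)
        = q - 1 / (1 - \<delta>) * (\<integral>x. max 0 (q - Y x) \<partial>M)"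
      using shifted[of q] \<open>\<delta> < 1\<close> by (simp add: field_simps)
    then show "(\<integral>x. indicator A x * Y x \<partial>M) / (1 - \<delta>)
        \<in> range (\<lambda>t. t - 1 / (1 - \<delta>) * (\<integral>x. max 0 (t - Y x) \<partial>M))"
      by (rule range_eqI)
  next
    fix y assume "y \<in> range (\<lambda>t. t - 1 / (1 - \<delta>) * (\<integral>x. max 0 (t - Y x) \<partial>M))"
    then obtain t where y: "y = t - 1 / (1 - \<delta>) * (\<integral>x. max 0 (t - Y x) \<partial>M)" by auto
    have "(\<integral>x. indicator A x * (t - Y x) \<partial>M) \<le> (\<integral>x. max 0 (t - Y x) \<partial>M)"
      by (intro integral_mono int_shifted int_pos) (auto simp: indicator_def)
    then have "y \<le> t - 1 / (1 - \<delta>) * ((1 - \<delta>) * t - (\<integral>x. indicator A x * Y x \<partial>M))"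
      using \<open>\<delta> < 1\<close> unfolding y shifted by (intro diff_left_mono mult_left_mono) auto
    also have "\<dots> = (\<integral>x. indicator A x * Y x \<partial>M) / (1 - \<delta>)"
      using \<open>\<delta> < 1\<close> by (simp add: field_simps)
    finally show "y \<le> (\<integral>x. indicator A x * Y x \<partial>M) / (1 - \<delta>)" .
  qed
  then show ?thesis using \<open>\<delta> < 1\<close> by (simp add: CVaR_def)
qed

text \<open>For \<delta> < 1, the penalty factor 1 / (1 - \<delta>) is at least 1, so nothing is
  gained by moving t beyond y.\<close>

lemma (in prob_space) CVaR_const:
  assumes "0 \<le> \<delta>" "\<delta> \<le> 1" and Y: "\<And>x. x \<in> space M \<Longrightarrow> Y x = y"
  shows "CVaR \<delta> M Y = y"
proof (cases "\<delta> = 1")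
  case True
  have "(AE x in M. c \<le> Y x) \<longleftrightarrow> c \<le> y" for c
  proof -
    have "(AE x in M. c \<le> Y x) \<longleftrightarrow> (AE x in M. c \<le> y)"
      by (intro AE_cong) (simp add: Y)
    then show ?thesis by simp
  qed
  then show ?thesis
    using True by (simp add: CVaR_def ess_inf_def atMost_def[symmetric])
next
  case False
  have "(\<integral>x. max 0 (t - Y x) \<partial>M) = max 0 (t - y)" for t
  proof -
    have "(\<integral>x. max 0 (t - Y x) \<partial>M) = (\<integral>x. max 0 (t - y) \<partial>M)"
      by (intro Bochner_Integration.integral_cong) (auto simp: Y)
    then show ?thesis by (simp add: prob_space)
  qed
  moreover have "(SUP t. t - 1 / (1 - \<delta>) * max 0 (t - y)) = y"
  proof (rule cSup_eq_maximum)
    show "y \<in> range (\<lambda>t. t - 1 / (1 - \<delta>) * max 0 (t - y))"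
      by (rule range_eqI[of _ _ y]) simp
    fix z assume "z \<in> range (\<lambda>t. t - 1 / (1 - \<delta>) * max 0 (t - y))"
    then obtain t where z: "z = t - 1 / (1 - \<delta>) * max 0 (t - y)" by auto
    have "1 * max 0 (t - y) \<le> 1 / (1 - \<delta>) * max 0 (t - y)"
      using assms False by (intro mult_right_mono) (auto simp: field_simps)
    moreover have "t - y \<le> 1 * max 0 (t - y)" by simp
    ultimately have "t - y \<le> 1 / (1 - \<delta>) * max 0 (t - y)" by (rule order_trans[rotated])
    then show "z \<le> y" unfolding z by (simp only: algebra_simps)
  qed
  ultimately show ?thesis using False by (simp add: CVaR_def)
qed

lemma CVaR_distr:
  assumes "f \<in> measurable M N" "Y \<in> borel_measurable N"
  shows "CVaR \<delta> (distr M N f) Y = CVaR \<delta> M (\<lambda>x. Y (f x))"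
proof -
  have "(\<integral>x. max 0 (t - Y x) \<partial>distr M N f) = (\<integral>x. max 0 (t - Y (f x)) \<partial>M)" for t
    using assms by (intro integral_distr) auto
  moreover have "(AE x in distr M N f. c \<le> Y x) \<longleftrightarrow> (AE x in M. c \<le> Y (f x))" for c
    using assms by (intro AE_distr_iff) auto
  ultimately show ?thesis by (simp add: CVaR_def ess_inf_def)
qed

section \<open>Inverse transform sampling\<close>

abbreviation unit_interval :: "real measure" where
  "unit_interval \<equiv> restrict_space lborel {0..1}"

lemma prob_space_unit_interval: "prob_space unit_interval"
  by (rule prob_space_restrict_space) auto

interpretation unit_interval: prob_space unit_interval
  by (rule prob_space_unit_interval)

lemma borel_measurable_unit_interval:
  "continuous_on {0..1} f \<Longrightarrow> f \<in> borel_measurable unit_interval"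
  using borel_measurable_continuous_on_restrict[of "{0..1}" f]
  by (simp add: measurable_cong_sets[OF sets_restrict_space_cong[OF sets_lborel] refl])

definition quantile_law :: "(real \<Rightarrow> real) \<Rightarrow> real measure" where
  "quantile_law \<phi> = distr unit_interval borel \<phi>"

lemma real_distribution_quantile_law:
  assumes "continuous_on {0..1} \<phi>"
  shows "real_distribution (quantile_law \<phi>)"
  unfolding quantile_law_def
  by (intro unit_interval.real_distribution_distr borel_measurable_unit_interval assms)

lemma measure_quantile_law_Icc:
  assumes "continuous_on {0..1} \<phi>" "\<phi> ` {0..1} \<subseteq> {a..b}"
  shows "measure (quantile_law \<phi>) {a..b} = 1"
proof -
  have "\<phi> -` {a..b} \<inter> space unit_interval = space unit_interval"
    using assms(2) by (auto simp: space_restrict_space)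
  then show ?thesis
    unfolding quantile_law_def
    using assms(1) unit_interval.prob_space
    by (simp add: measure_distr borel_measurable_unit_interval)
qed

lemma compact_sublevel:
  fixes \<phi> :: "real \<Rightarrow> real"
  assumes "continuous_on {0..1} \<phi>"
  shows "compact {t \<in> {0..1}. \<phi> t \<le> x}"
proof -
  have "closed ({0..1} \<inter> \<phi> -` {..x})"
    by (intro continuous_closed_preimage assms) auto
  moreover have "{t \<in> {0..1}. \<phi> t \<le> x} = {0..1} \<inter> ({0..1} \<inter> \<phi> -` {..x})" by auto
  ultimately show ?thesis by (metis compact_Icc compact_Int_closed)
qed

text \<open>A nonempty sublevel set of \<phi> is an initial segment [0, q], by monotonicity and
  compactness. Its length q is the value of the CDF, and p \<le> q holds exactly when \<phi> p \<le>
  x.\<close>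

lemma le_cdf_quantile_law_iff:
  assumes "continuous_on {0..1} \<phi>" "mono_on {0..1} \<phi>" "p \<in> {0<..1}"
  shows "p \<le> cdf (quantile_law \<phi>) x \<longleftrightarrow> \<phi> p \<le> x"
proof -
  let ?S = "{t \<in> {0..1}. \<phi> t \<le> x}"
  have "cdf (quantile_law \<phi>) x = measure unit_interval (\<phi> -` {..x} \<inter> space unit_interval)"
    unfolding cdf_def quantile_law_def
    using assms by (intro measure_distr borel_measurable_unit_interval) auto
  also have "\<phi> -` {..x} \<inter> space unit_interval = ?S"
    by (auto simp: space_restrict_space)
  also have "measure unit_interval ?S = measure lborel ?S"
    by (rule measure_restrict_space) auto
  finally have cdf: "cdf (quantile_law \<phi>) x = measure lborel ?S" .
  have S: "?S \<in> fmeasurable lborel"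
    using fmeasurable_compact[OF compact_sublevel[OF assms(1)]] .
  show ?thesis
  proof
    assume "p \<le> cdf (quantile_law \<phi>) x"
    then have p: "p \<le> measure lborel ?S" by (simp add: cdf)
    \<comment> \<open>This is where p > 0 matters: p = 0 would lie below the CDF even at an x with
      empty sublevel set.\<close>
    have "?S \<noteq> {}"
    proof
      assume "?S = {}"
      with p have "p \<le> 0" by (simp only: measure_empty)
      then show False using assms(3) by simp
    qed
    then obtain q where q: "q \<in> ?S" "\<And>t. t \<in> ?S \<Longrightarrow> t \<le> q"
      using compact_attains_sup[OF compact_sublevel[OF assms(1)]] by blast
    have "measure lborel ?S \<le> measure lborel {0..q}"
      using S q by (intro measure_mono_fmeasurable fmeasurable_compact) auto
    then have "p \<le> q" using p q by auto
    then show "\<phi> p \<le> x"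
      using q assms mono_onD[OF assms(2), of p q] by auto
  next
    assume "\<phi> p \<le> x"
    then have "{0..p} \<subseteq> ?S"
      using assms mono_onD[OF assms(2), of _ p] by force
    then have "measure lborel {0..p} \<le> measure lborel ?S"
      using S by (intro measure_mono_fmeasurable) auto
    then show "p \<le> cdf (quantile_law \<phi>) x" using cdf assms by simp
  qed
qed

lemma inverse_cdf_quantile_law:
  assumes "continuous_on {0..1} \<phi>" "mono_on {0..1} \<phi>" "p \<in> {0<..1}" "\<phi> p \<in> {a..b}"
  shows "inverse_cdf a b (quantile_law \<phi>) p = \<phi> p"
proof -
  have "{x \<in> {a..b}. p \<le> cdf (quantile_law \<phi>) x} = {\<phi> p..b}"
    unfolding le_cdf_quantile_law_iff[OF assms(1-3)] using assms(4) by auto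
  then show ?thesis using assms by (simp add: inverse_cdf_def)
qed

text \<open>At p = 0 the infimum only sees the left end of the interval. Hence \<phi> 0 is recovered
  with the interval from \<phi> 0 to \<phi> 1, whereas with [L, U] the identity is claimed for p > 0
  only.\<close>

lemma inverse_cdf_0: "a \<le> b \<Longrightarrow> inverse_cdf a b M 0 = a"
proof -
  assume "a \<le> b"
  moreover have "{x \<in> {a..b}. 0 \<le> cdf M x} = {a..b}" by (auto simp: cdf_def)
  ultimately show ?thesis by (simp add: inverse_cdf_def)
qed

lemma borel_measurable_threshold_profit: "threshold_profit L v \<in> borel_measurable borel"
  unfolding threshold_profit_def[abs_def] by measurable

lemma CVaR_quantile_law_profit:
  assumes "continuous_on {0..1} \<phi>"
  shows "CVaR \<delta> (quantile_law \<phi>) (threshold_profit L v)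
    = CVaR \<delta> unit_interval (\<lambda>t. threshold_profit L v (\<phi> t))"
  unfolding quantile_law_def
  by (intro CVaR_distr borel_measurable_unit_interval borel_measurable_threshold_profit assms)

lemma CVaR_profit_below:
  assumes "continuous_on {0..1} \<phi>" "0 \<le> \<delta>" "\<delta> \<le> 1" "\<And>t. t \<in> {0..1} \<Longrightarrow> v < \<phi> t"
  shows "CVaR \<delta> (quantile_law \<phi>) (threshold_profit L v) = L"
  unfolding CVaR_quantile_law_profit[OF assms(1)]
  by (rule unit_interval.CVaR_const)
     (use assms in \<open>force simp: threshold_profit_def space_restrict_space indicator_def\<close>)+

section \<open>Competitive ratio of the threshold curve\<close>

lemma threshold_curve_properties:
  assumes "0 < L" "L \<le> U" "0 \<le> \<delta>" "\<delta> < 1" "threshold_curve L U \<delta> a \<phi>"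
  shows "1 \<le> a" "continuous_on {0..1} \<phi>" "mono_on {0..1} \<phi>"
proof -
  let ?\<psi> = "\<lambda>t. L * (1 + (a - 1) * delay_exp \<delta> (a / (1 - \<delta>)) t)"
  have eq: "\<And>t. t \<in> {0..1} \<Longrightarrow> \<phi> t = ?\<psi> t" and a: "1 \<le> a"
    using assms threshold_curve_iff by auto
  have "mono_on {0..1} ?\<psi>"
    using a assms
    by (auto intro!: mono_onI mult_left_mono add_left_mono delay_exp_mono)
  then show "mono_on {0..1} \<phi>"
    using eq by (auto simp: mono_on_def)
  have init: "\<And>t. t \<in> {0..\<delta>} \<Longrightarrow> \<phi> t = a * L"
    and deriv: "\<And>t. t \<in> {\<delta>..1} \<Longrightarrow>
      (\<phi> has_real_derivative a / (1 - \<delta>) * (\<phi> (t - \<delta>) - L)) (at t within {\<delta>..1})"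
    using assms by (auto simp: threshold_curve_def)
  have "continuous_on {0..\<delta>} \<phi>"
    using init by (subst continuous_on_cong[OF refl, of _ _ "\<lambda>_. a * L"]) auto
  moreover have "continuous_on {\<delta>..1} \<phi>"
    using deriv by (rule DERIV_continuous_on)
  moreover have "{0..1} = {0..\<delta>} \<union> {\<delta>..1}" using assms by auto
  ultimately show "continuous_on {0..1} \<phi>"
    by (metis closed_atLeastAtMost continuous_on_closed_Un)
  show "1 \<le> a" by fact
qed

text \<open>The delay equation, solved for the delayed value, reads \<phi> t = L + (1 - \<delta>) /
  a * \<phi>' (t + \<delta>). Its right-hand side has the antiderivative \<open>F\<close>.\<close>

lemma integral_threshold_curve:
  assumes "0 < L" "L \<le> U" "0 \<le> \<delta>" "\<delta> < 1" "threshold_curve L U \<delta> a \<phi>" "s \<in> {\<delta>..1}"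
  shows "(\<integral>t. indicator {0..s - \<delta>} t * \<phi> t \<partial>lborel)
    = (s - \<delta>) * L + (1 - \<delta>) / a * (\<phi> s - a * L)"
proof -
  note curve = threshold_curve_properties[OF assms(1-5)]
  define F where "F t = L * t + (1 - \<delta>) / a * \<phi> (t + \<delta>)" for t
  have "(\<integral>t. indicator {0..s - \<delta>} t *\<^sub>R \<phi> t \<partial>lborel) = F (s - \<delta>) - F 0"
  proof (rule integral_FTC_Icc)
    show "continuous_on {0..s - \<delta>} \<phi>"
      by (rule continuous_on_subset[OF curve(2)]) (use assms in auto)
    fix t assume t: "0 \<le> t" "t \<le> s - \<delta>"
    have "(\<phi> has_real_derivative a / (1 - \<delta>) * (\<phi> t - L)) (at (t + \<delta>) within {\<delta>..1})"
    proof -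
      have "t + \<delta> \<in> {\<delta>..1}" using t assms by auto
      then show ?thesis
        using assms(4,5) unfolding threshold_curve_def
        by (metis add_diff_cancel_right' less_irrefl)
    qed
    then have "(\<phi> has_real_derivative a / (1 - \<delta>) * (\<phi> t - L))
        (at (t + \<delta>) within (\<lambda>t. t + \<delta>) ` {0..s - \<delta>})"
      by (rule DERIV_subset) (use assms in auto)
    then have "(\<phi> \<circ> (\<lambda>t. t + \<delta>) has_real_derivative a / (1 - \<delta>) * (\<phi> t - L) * 1)
        (at t within {0..s - \<delta>})"
      by (rule DERIV_image_chain) (auto intro!: derivative_eq_intros)
    then have "((\<lambda>t. \<phi> (t + \<delta>)) has_real_derivative a / (1 - \<delta>) * (\<phi> t - L))
        (at t within {0..s - \<delta>})"
      by (simp add: o_def)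
    then have "(F has_real_derivative L * 1 + (1 - \<delta>) / a * (a / (1 - \<delta>) * (\<phi> t - L)))
        (at t within {0..s - \<delta>})"
      unfolding F_def by (intro DERIV_add DERIV_cmult DERIV_ident)
    then show "(F has_vector_derivative \<phi> t) (at t within {0..s - \<delta>})"
      using curve(1) assms by (simp add: has_real_derivative_iff_has_vector_derivative)
  qed (use assms in auto)
  moreover have "\<phi> \<delta> = a * L"
    using assms by (auto simp: threshold_curve_def)
  ultimately show ?thesis by (simp add: F_def algebra_simps)
qed

lemma CVaR_profit_threshold_curve:
  assumes "0 < L" "L \<le> U" "0 \<le> \<delta>" "\<delta> < 1" "threshold_curve L U \<delta> a \<phi>" "v \<in> {a * L..U}"
  shows "CVaR \<delta> (quantile_law \<phi>) (threshold_profit L v) = v / a"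
proof -
  note curve = threshold_curve_properties[OF assms(1-5)]
  have init: "\<phi> \<delta> = a * L" "\<phi> 1 = U" and range: "\<And>t. t \<in> {0..1} \<Longrightarrow> L \<le> \<phi> t"
    using assms by (auto simp: threshold_curve_def)
  let ?S = "{t \<in> {0..1}. \<phi> t \<le> v}"
  have "\<delta> \<in> ?S" using assms init by auto
  \<comment> \<open>The largest s is taken because \<phi> can be flat, as it is on [0, \<delta>].
    With it, \<phi> t \<le> v holds exactly when t \<le> s.\<close>
  then obtain s where s: "s \<in> ?S" "\<And>t. t \<in> ?S \<Longrightarrow> t \<le> s"
    using compact_attains_sup[OF compact_sublevel[OF curve(2), of v]] by blast
  have "\<delta> \<le> s" using s(2) \<open>\<delta> \<in> ?S\<close> by blast
  \<comment> \<open>The price v lies between \<phi> \<delta> and \<phi> 1, so it is attained; hence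
    \<phi> s = v and not merely \<phi> s \<le> v.\<close>
  have "\<exists>u\<ge>\<delta>. u \<le> 1 \<and> \<phi> u = v"
    using assms init by (intro IVT' continuous_on_subset[OF curve(2)]) auto
  then obtain u where u: "\<delta> \<le> u" "u \<le> 1" "\<phi> u = v" by blast
  then have "u \<in> ?S" using assms by auto
  then have "\<phi> u \<le> \<phi> s"
    using s by (intro mono_onD[OF curve(3)]) auto
  then have "\<phi> s = v" using s u by auto
  have profit: "threshold_profit L v (\<phi> t) = (if t \<le> s then \<phi> t else L)" if "t \<in> {0..1}" for t
  proof -
    have "\<phi> t \<le> v \<longleftrightarrow> t \<le> s"
      using that s(2)[of t] mono_onD[OF curve(3), of t s] s(1) by fastforce
    then show ?thesis by (simp add: threshold_profit_def indicator_def flip: not_le)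
  qed
  \<comment> \<open>The best outcomes are the block from s - \<delta> to s, of length \<delta>. The
    rest has probability 1 - \<delta>, and \<phi> (s - \<delta>) is the separating level.\<close>
  define A where "A = {0..s - \<delta>} \<union> {s<..1}"
  let ?Y = "\<lambda>t. threshold_profit L v (\<phi> t)"
  have "CVaR \<delta> unit_interval ?Y = (\<integral>t. indicator A t * ?Y t \<partial>unit_interval) / (1 - \<delta>)"
  proof (rule unit_interval.CVaR_eq_integral_lower_part)
    show "integrable unit_interval ?Y"
    proof (rule unit_interval.integrable_const_bound[where B = U])
      show "?Y \<in> borel_measurable unit_interval"
        by (rule measurable_compose[OF borel_measurable_unit_interval[OF curve(2)]
              borel_measurable_threshold_profit])
      have "norm (?Y t) \<le> U" if "t \<in> {0..1}" for t
        using that range[of t] profit[OF that] assms mono_onD[OF curve(3), of t 1] init by auto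
      then show "AE t in unit_interval. norm (?Y t) \<le> U"
        by (intro AE_I2) (auto simp: space_restrict_space)
    qed
    show "A \<in> sets unit_interval"
      using s assms by (auto simp: sets_restrict_space_iff A_def)
    have "measure unit_interval A = measure lborel A"
      using s assms by (intro measure_restrict_space) (auto simp: A_def)
    also have "\<dots> = measure lborel {0..s - \<delta>} + measure lborel {s<..1}"
      unfolding A_def using s \<open>\<delta> \<le> s\<close> assms by (intro measure_Un_AE AE_I2 fmeasurableI) auto
    finally show "measure unit_interval A = 1 - \<delta>"
      using s \<open>\<delta> \<le> s\<close> by simp
    show "?Y t \<le> \<phi> (s - \<delta>)" if "t \<in> A" for t
      using that s \<open>\<delta> \<le> s\<close> assms profit[of t] range[of "s - \<delta>"]
        mono_onD[OF curve(3), of t "s - \<delta>"] by (auto simp: A_def)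
    show "\<phi> (s - \<delta>) \<le> ?Y t" if "t \<in> space unit_interval - A" for t
      using that s \<open>\<delta> \<le> s\<close> assms profit[of t]
        mono_onD[OF curve(3), of "s - \<delta>" t] by (auto simp: A_def space_restrict_space)
  qed fact
  also have "(\<integral>t. indicator A t * ?Y t \<partial>unit_interval)
      = (\<integral>t. indicator {0..1} t *\<^sub>R (indicator A t * ?Y t) \<partial>lborel)"
    by (rule integral_restrict_space) auto
  also have "\<dots> = (\<integral>t. indicator {0..s - \<delta>} t * \<phi> t + indicator {s<..1} t * L \<partial>lborel)"
    using s assms profit
    by (intro Bochner_Integration.integral_cong) (auto simp: A_def indicator_def)
  also have "\<dots> = (\<integral>t. indicator {0..s - \<delta>} t * \<phi> t \<partial>lborel) + (\<integral>t. indicator {s<..1} t * L \<partial>lborel)"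
  proof (rule Bochner_Integration.integral_add)
    have "continuous_on {0..s - \<delta>} \<phi>"
      by (rule continuous_on_subset[OF curve(2)]) (use s assms in auto)
    then show "integrable lborel (\<lambda>t. indicator {0..s - \<delta>} t * \<phi> t)"
      using borel_integrable_atLeastAtMost'[of 0 "s - \<delta>" \<phi>] by (simp add: set_integrable_def)
  qed (use s in auto)
  \<comment> \<open>The terms in L cancel: (s - \<delta>) L and (1 - s) L add up to (1 - \<delta>)
    L, which offsets (1 - \<delta>) / a * a L.\<close>
  also have "\<dots> = (1 - \<delta>) * (v / a)"
    using integral_threshold_curve[OF assms(1-5), of s] s \<open>\<delta> \<le> s\<close> \<open>\<phi> s = v\<close> curve(1)
    by (simp add: field_simps)
  finally show ?thesis
    using assms CVaR_quantile_law_profit[OF curve(2)] by simp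
qed

text \<open>The ratio is exactly a for every price in [a L, U]. Below a L no threshold is reached,
  CVaR is L, and v / L < a.\<close>

lemma competitive_ratio_threshold_curve:
  assumes "0 < L" "L \<le> U" "0 \<le> \<delta>" "\<delta> < 1" "threshold_curve L U \<delta> a \<phi>"
  shows "CVaR_competitive_ratio L U \<delta> (quantile_law \<phi>) = a"
  unfolding CVaR_competitive_ratio_def
proof (rule cSup_eq_maximum)
  note curve = threshold_curve_properties[OF assms]
  let ?ratio = "\<lambda>v. v / CVaR \<delta> (quantile_law \<phi>) (threshold_profit L v)"
  have \<phi>: "\<phi> 0 = a * L" "a * L \<le> U"
    using assms by (auto simp: threshold_curve_def Pi_iff dest: bspec[of _ _ 0])
  have ratio: "?ratio v = a" if "v \<in> {a * L..U}" for v
  proof -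
    have "0 < v" using that curve(1) assms by (smt (verit) atLeastAtMost_iff mult_pos_pos)
    then show ?thesis
      using CVaR_profit_threshold_curve[OF assms that] by simp
  qed
  have "L \<le> U" by fact
  then show "a \<in> ?ratio ` {L..U}"
    using ratio[of U] \<phi> by (intro image_eqI[of _ _ U]) auto
  fix y assume "y \<in> ?ratio ` {L..U}"
  then obtain v where v: "v \<in> {L..U}" "y = ?ratio v" by auto
  show "y \<le> a"
  proof (cases "v < a * L")
    case True
    have "v < \<phi> t" if "t \<in> {0..1}" for t
      using True \<phi> mono_onD[OF curve(3), of 0 t] that by auto
    then have "CVaR \<delta> (quantile_law \<phi>) (threshold_profit L v) = L"
      using CVaR_profit_below[OF curve(2), of \<delta> v L] assms by simp
    then show ?thesis using True v(2) assms(1) by (simp add: pos_divide_le_eq)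
  next
    case False
    then show ?thesis using ratio[of v] v by auto
  qed
qed

text \<open>A deterministic threshold makes the profit constant, so CVaR is the profit itself. The
  threshold balances the two risks: U / (a L) = a, and v / L < a for rejected prices v.\<close>

lemma competitive_ratio_constant_threshold:
  assumes "0 < L" "L \<le> U" "\<And>t. t \<in> {0..1} \<Longrightarrow> \<phi> t = sqrt (U / L) * L"
  shows "CVaR_competitive_ratio L U 1 (quantile_law \<phi>) = sqrt (U / L)"
  unfolding CVaR_competitive_ratio_def
proof (rule cSup_eq_maximum)
  define a where "a = sqrt (U / L)"
  have a: "1 \<le> a" "a * (a * L) = U"
    using assms by (auto simp: a_def mult.assoc[symmetric])
  have "continuous_on {0..1} \<phi>"
    using assms(3) by (subst continuous_on_cong[OF refl, of _ _ "\<lambda>_. sqrt (U / L) * L"]) auto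
  note CVaR_eq = CVaR_quantile_law_profit[OF this, of 1 L]
  let ?ratio = "\<lambda>v. v / CVaR 1 (quantile_law \<phi>) (threshold_profit L v)"
  have CVaR: "CVaR 1 (quantile_law \<phi>) (threshold_profit L v) = (if v < a * L then L else a * L)" for v
    unfolding CVaR_eq
    by (rule unit_interval.CVaR_const)
       (use assms(3) in \<open>auto simp: a_def threshold_profit_def space_restrict_space indicator_def\<close>)
  have "a * L \<le> U"
    using a mult_right_mono[of 1 a "a * L"] assms(1) by simp
  then have "?ratio U = a"
    using CVaR[of U] a assms(1) by (auto simp: field_simps)
  then show "sqrt (U / L) \<in> ?ratio ` {L..U}"
    using assms by (intro image_eqI[of _ _ U]) (auto simp: a_def)
  fix y assume "y \<in> ?ratio ` {L..U}"
  then obtain v where v: "v \<in> {L..U}" "y = ?ratio v" by auto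
  have "y \<le> a"
    using v CVaR[of v] a assms(1) by (auto simp: field_simps split: if_splits)
  then show "y \<le> sqrt (U / L)" by (simp add: a_def)
qed

section \<open>Assembling the algorithm and the theorem\<close>

lemma threshold_curve_competitive_algorithm:
  assumes "0 < L" "L \<le> U" "0 \<le> \<delta>" "\<delta> \<le> 1" and curve: "threshold_curve L U \<delta> a \<phi>"
  shows "\<exists>\<mu>. random_threshold_alg L U \<mu> \<and>
    measure \<mu> {\<phi> 0..\<phi> 1} = 1 \<and>
    (\<forall>p\<in>{0..1}. inverse_cdf (\<phi> 0) (\<phi> 1) \<mu> p = \<phi> p) \<and>
    (\<forall>p\<in>{0<..1}. inverse_cdf L U \<mu> p = \<phi> p) \<and>
    CVaR_competitive_ratio L U \<delta> \<mu> = a"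
proof -
  have range: "\<And>t. t \<in> {0..1} \<Longrightarrow> \<phi> t \<in> {L..U}"
    using curve by (auto simp: threshold_curve_def)
  \<comment> \<open>The witness will be \<open>quantile_law \<phi>\<close>. Only these three facts
    are proved separately for \<delta> = 1 and \<delta> < 1.\<close>
  have "continuous_on {0..1} \<phi> \<and> mono_on {0..1} \<phi> \<and>
    CVaR_competitive_ratio L U \<delta> (quantile_law \<phi>) = a"
  proof (cases "\<delta> = 1")
    case True
    then have const: "\<And>t. t \<in> {0..1} \<Longrightarrow> \<phi> t = sqrt (U / L) * L" and "a = sqrt (U / L)"
      using curve by (auto simp: threshold_curve_def)
    moreover have "continuous_on {0..1} \<phi>"
      using const by (subst continuous_on_cong[OF refl, of _ _ "\<lambda>_. sqrt (U / L) * L"]) auto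
    moreover have "mono_on {0..1} \<phi>"
      using const by (auto intro!: mono_onI)
    ultimately show ?thesis
      using True competitive_ratio_constant_threshold[OF assms(1,2) const] by simp
  next
    case False
    then have "\<delta> < 1" using assms by simp
    then show ?thesis
      using threshold_curve_properties[OF assms(1-3) _ curve]
        competitive_ratio_threshold_curve[OF assms(1-3) _ curve] by simp
  qed
  then have cont: "continuous_on {0..1} \<phi>" and mono: "mono_on {0..1} \<phi>"
    and ratio: "CVaR_competitive_ratio L U \<delta> (quantile_law \<phi>) = a" by auto
  have \<phi>_bounds: "\<phi> t \<in> {\<phi> 0..\<phi> 1}" if "t \<in> {0..1}" for t
    using mono_onD[OF mono, of 0 t] mono_onD[OF mono, of t 1] that by auto
  have "inverse_cdf (\<phi> 0) (\<phi> 1) (quantile_law \<phi>) p = \<phi> p" if "p \<in> {0..1}" for p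
  proof (cases "p = 0")
    case True
    then show ?thesis using \<phi>_bounds[of 0] by (simp add: inverse_cdf_0)
  next
    case False
    then show ?thesis
      using that by (intro inverse_cdf_quantile_law cont mono \<phi>_bounds) auto
  qed
  moreover have "inverse_cdf L U (quantile_law \<phi>) p = \<phi> p" if "p \<in> {0<..1}" for p
    using that by (intro inverse_cdf_quantile_law cont mono range) auto
  moreover have "measure (quantile_law \<phi>) {\<phi> 0..\<phi> 1} = 1"
    by (rule measure_quantile_law_Icc[OF cont image_subsetI]) (rule \<phi>_bounds)
  moreover have "random_threshold_alg L U (quantile_law \<phi>)"
    unfolding random_threshold_alg_def
    using real_distribution_quantile_law[OF cont]
      measure_quantile_law_Icc[OF cont image_subsetI, OF range] by blast
  ultimately show ?thesis using ratio by blast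
qed

lemma threshold_curve_alpha:
  assumes "0 < L" "L \<le> U" "\<theta> = U / L" "0 \<le> \<delta>" "\<delta> \<le> 1"
  shows "\<exists>\<phi>. threshold_curve L U \<delta> (alpha \<theta> \<delta>) \<phi>"
    and "threshold_curve L U \<delta> a \<phi> \<Longrightarrow> a = alpha \<theta> \<delta>"
    and "threshold_curve L U \<delta> a \<phi> \<Longrightarrow> threshold_curve L U \<delta> a \<psi> \<Longrightarrow> t \<in> {0..1} \<Longrightarrow> \<phi> t = \<psi> t"
proof -
  have \<theta>: "1 \<le> \<theta>" using assms by simp
  show "\<exists>\<phi>. threshold_curve L U \<delta> (alpha \<theta> \<delta>) \<phi>"
  proof (cases "\<delta> = 1")
    case True
    have sqrt: "1 \<le> sqrt \<theta>" using \<theta> by simp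
    then have "sqrt \<theta> * L \<le> sqrt \<theta> * (sqrt \<theta> * L)" "1 * L \<le> sqrt \<theta> * L"
      using assms(1) by (auto intro!: mult_right_mono)
    moreover have "sqrt \<theta> * (sqrt \<theta> * L) = U"
      using \<theta> assms(1,3) by (simp add: mult.assoc[symmetric])
    ultimately have "threshold_curve L U 1 (sqrt \<theta>) (\<lambda>_. sqrt \<theta> * L)"
      using assms(3) by (auto simp: threshold_curve_def)
    then show ?thesis using True alpha_1[OF \<theta>] by auto
  next
    case False
    then show ?thesis
      using threshold_curve_iff[of L U \<delta>] alpha_eqn[OF \<theta>, of \<delta>] assms by auto
  qed
  show "a = alpha \<theta> \<delta>" if "threshold_curve L U \<delta> a \<phi>"
  proof (cases "\<delta> = 1")
    case True
    then show ?thesis using that alpha_1[OF \<theta>] assms(3) by (simp add: threshold_curve_def)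
  next
    case False
    then show ?thesis
      using that threshold_curve_iff[of L U \<delta>] alpha_unique[OF \<theta>, of \<delta> a] assms by auto
  qed
  show "\<phi> t = \<psi> t" if "threshold_curve L U \<delta> a \<phi>" "threshold_curve L U \<delta> a \<psi>" "t \<in> {0..1}"
  proof (cases "\<delta> = 1")
    case True
    then show ?thesis using that by (simp add: threshold_curve_def)
  next
    case False
    then show ?thesis
      using that threshold_curve_iff[of L U \<delta>] assms by simp
  qed
qed

theorem theorem6:
  fixes L U \<theta> \<delta> :: real
  assumes "0 < L" and "L \<le> U" and "\<theta> = U / L" and "\<delta> \<in> {0..1}"
  shows
    "(\<exists>\<phi>. threshold_curve L U \<delta> (alpha \<theta> \<delta>) \<phi>) \<and>
     (\<forall>a \<phi>. threshold_curve L U \<delta> a \<phi> \<longrightarrow> a = alpha \<theta> \<delta>) \<and>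
     (\<forall>\<phi> \<psi>. threshold_curve L U \<delta> (alpha \<theta> \<delta>) \<phi> \<and> threshold_curve L U \<delta> (alpha \<theta> \<delta>) \<psi>
        \<longrightarrow> (\<forall>t\<in>{0..1}. \<phi> t = \<psi> t)) \<and>
     (\<forall>\<phi>. threshold_curve L U \<delta> (alpha \<theta> \<delta>) \<phi> \<longrightarrow>
        (\<exists>\<mu>. random_threshold_alg L U \<mu> \<and>
             measure \<mu> {\<phi> 0..\<phi> 1} = 1 \<and>
             (\<forall>p\<in>{0..1}. inverse_cdf (\<phi> 0) (\<phi> 1) \<mu> p = \<phi> p) \<and>
             (\<forall>p\<in>{0<..1}. inverse_cdf L U \<mu> p = \<phi> p) \<and>
             CVaR_competitive_ratio L U \<delta> \<mu> = alpha \<theta> \<delta>)) \<and>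
     (\<exists>!r. 0 < r \<and> r_bar_equation \<theta> \<delta> r) \<and>
     (r_bar \<theta> \<longlongrightarrow> r_bar \<theta> 0) (at_right 0) \<and>
     alpha \<theta> \<delta> \<le> r_bar \<theta> \<delta> \<and>
     (\<exists>g \<in> O[at_right 0](\<lambda>d. d).
        \<forall>\<^sub>F d in at_right 0. alpha \<theta> d \<le> 1 + lambert_W0 ((\<theta> - 1) / exp 1) + g d) \<and>
     (1 / 5 < \<delta> \<longrightarrow> alpha \<theta> \<delta> \<le> sqrt \<theta>) \<and>
     (1 / 2 \<le> \<delta> \<longrightarrow> alpha \<theta> \<delta> = sqrt \<theta>)"
proof -
  have \<delta>: "0 \<le> \<delta>" "\<delta> \<le> 1" and \<theta>: "1 \<le> \<theta>" using assms by auto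
  note curve = threshold_curve_alpha[OF assms(1-3) \<delta>]
  show ?thesis
  proof (intro conjI allI impI ballI)
    show "\<exists>\<phi>. threshold_curve L U \<delta> (alpha \<theta> \<delta>) \<phi>" by (rule curve(1))
    show "a = alpha \<theta> \<delta>" if "threshold_curve L U \<delta> a \<phi>" for a \<phi>
      using that by (rule curve(2))
    show "\<phi> t = \<psi> t"
      if "threshold_curve L U \<delta> (alpha \<theta> \<delta>) \<phi> \<and> threshold_curve L U \<delta> (alpha \<theta> \<delta>) \<psi>"
        "t \<in> {0..1}" for \<phi> \<psi> t
      using curve(3) that by blast
    show "\<exists>\<mu>. random_threshold_alg L U \<mu> \<and> measure \<mu> {\<phi> 0..\<phi> 1} = 1 \<and>
        (\<forall>p\<in>{0..1}. inverse_cdf (\<phi> 0) (\<phi> 1) \<mu> p = \<phi> p) \<and>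
        (\<forall>p\<in>{0<..1}. inverse_cdf L U \<mu> p = \<phi> p) \<and>
        CVaR_competitive_ratio L U \<delta> \<mu> = alpha \<theta> \<delta>"
      if "threshold_curve L U \<delta> (alpha \<theta> \<delta>) \<phi>" for \<phi>
      using threshold_curve_competitive_algorithm[OF assms(1,2) \<delta> that] .
    show "\<exists>!r. 0 < r \<and> r_bar_equation \<theta> \<delta> r" by (rule r_bar_equation_ex1[OF \<theta>])
    show "(r_bar \<theta> \<longlongrightarrow> r_bar \<theta> 0) (at_right 0)" by (rule r_bar_tendsto[OF \<theta>])
    show "alpha \<theta> \<delta> \<le> r_bar \<theta> \<delta>" by (rule alpha_le_r_bar[OF \<theta> \<delta>])
    show "\<exists>g \<in> O[at_right 0](\<lambda>d. d).
        \<forall>\<^sub>F d in at_right 0. alpha \<theta> d \<le> 1 + lambert_W0 ((\<theta> - 1) / exp 1) + g d"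
      by (rule alpha_asymptotics[OF \<theta>])
    show "alpha \<theta> \<delta> \<le> sqrt \<theta>" if "1 / 5 < \<delta>"
      using alpha_le_r_bar[OF \<theta> \<delta>] r_bar_eq_sqrt[OF \<theta> that] by simp
    show "alpha \<theta> \<delta> = sqrt \<theta>" if "1 / 2 \<le> \<delta>"
      using \<theta> that \<delta>(2) by (rule alpha_eq_sqrt)
  qed
qed

end
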